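(* Let $G$ be a bipartite graph with sides $A$ and $B$, both infinite and countable, such that $G$ is a dHp graph. If the set of vertices of $A$ that are pseudo-isolated in $G$ is finite, then there is a collection of pairwise vertex-disjoint 2-regular subgraphs of $G$ that covers all vertices of $A$.
   Context: For $X\subseteq V(G)$ with $|X|\ge 2$, $N^2(X)$ denotes the set of vertices of $G$ having at least two neighbours in $X$. A bipartite graph $G$ with sides $A$ and $B$ is a dHp graph if $|A|\ge 2$ and $|N^2(X)|\ge |X|$ for every $X\subseteq A$ with $|X|\ge 2$. A vertex $v$ of an infinite graph $G$ is pseudo-isolated if there exists a finite set $F\subset V(G)\setminus\{v\}$ such that no vertex $w$ of $G\setminus F$ satisfies $d_{G\setminus F}(v,w)=2$. A 2-regular subgraph is a subgraph in which every vertex has degree exactly $2$. A collection of subgraphs covers $A$ if every vertex of $A$ lies in one of them. *)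

theory Defs
  imports Main "HOL-Library.Equipollence" "HOL-Library.Extended_Nat" "HOL-Library.Countable_Set"
begin

record 'a ugraph =
  vertices :: "'a set"
  edges :: "'a set set"

definition simple_graph :: "'a ugraph \<Rightarrow> bool" where
  "simple_graph G \<longleftrightarrow> (\<forall>e\<in>edges G. e \<subseteq> vertices G \<and> card e = 2)"

definition bipartite :: "'a ugraph \<Rightarrow> 'a set \<Rightarrow> 'a set \<Rightarrow> bool" where
  "bipartite G A B \<longleftrightarrow> simple_graph G \<and> vertices G = A \<union> B \<and> A \<inter> B = {} \<and>
     (\<forall>e\<in>edges G. \<exists>a\<in>A. \<exists>b\<in>B. e = {a, b})"

definition nbrs :: "'a ugraph \<Rightarrow> 'a \<Rightarrow> 'a set" where
  "nbrs G v = {w \<in> vertices G. {v, w} \<in> edges G}"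

text \<open>Not phrased with \<^const>\<open>card\<close>, which is 0 on infinite sets.\<close>

definition at_least_two :: "'a set \<Rightarrow> bool" where
  "at_least_two S \<longleftrightarrow> (\<exists>x\<in>S. \<exists>y\<in>S. x \<noteq> y)"

definition N2 :: "'a ugraph \<Rightarrow> 'a set \<Rightarrow> 'a set" where
  "N2 G X = {v \<in> vertices G. at_least_two (nbrs G v \<inter> X)}"

text \<open>The set \<open>X\<close> may be infinite, so the sizes are compared as cardinals.\<close>

definition dHp_graph :: "'a ugraph \<Rightarrow> 'a set \<Rightarrow> 'a set \<Rightarrow> bool" where
  "dHp_graph G A B \<longleftrightarrow> bipartite G A B \<and> at_least_two A \<and>
     (\<forall>X. X \<subseteq> A \<and> at_least_two X \<longrightarrow> X \<lesssim> N2 G X)"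

definition delete_vertices :: "'a ugraph \<Rightarrow> 'a set \<Rightarrow> 'a ugraph" where
  "delete_vertices G F = \<lparr>vertices = vertices G - F, edges = {e \<in> edges G. e \<inter> F = {}}\<rparr>"

definition walk :: "'a ugraph \<Rightarrow> 'a list \<Rightarrow> bool" where
  "walk G p \<longleftrightarrow> p \<noteq> [] \<and> set p \<subseteq> vertices G \<and> successively (\<lambda>x y. {x, y} \<in> edges G) p"

text \<open>The infimum of the empty set is \<open>\<infinity>\<close>, which gives the distance of vertices in
  different components.\<close>

definition gdist :: "'a ugraph \<Rightarrow> 'a \<Rightarrow> 'a \<Rightarrow> enat" where
  "gdist G u v = (INF p \<in> {p. walk G p \<and> hd p = u \<and> last p = v}. enat (length p - 1))"

definition pseudo_isolated :: "'a ugraph \<Rightarrow> 'a \<Rightarrow> bool" where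
  "pseudo_isolated G v \<longleftrightarrow> v \<in> vertices G \<and>
     (\<exists>F. finite F \<and> F \<subseteq> vertices G - {v} \<and>
        (\<forall>w \<in> vertices (delete_vertices G F). gdist (delete_vertices G F) v w \<noteq> 2))"

definition subgraph :: "'a ugraph \<Rightarrow> 'a ugraph \<Rightarrow> bool" where
  "subgraph H G \<longleftrightarrow> simple_graph H \<and> vertices H \<subseteq> vertices G \<and> edges H \<subseteq> edges G"

definition two_regular :: "'a ugraph \<Rightarrow> bool" where
  "two_regular H \<longleftrightarrow> (\<forall>v \<in> vertices H. card (nbrs H v) = 2)"

end

theory Submission
  imports Defs "HOL-Library.Disjoint_Sets"
begin

text \<open>
  Let \<open>P\<close> be a finite set of vertices of \<open>A\<close> with at least two elements that contains the
  pseudo-isolated ones. The double Hall property is inherited by the graph between \<open>P\<close> and a suitable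
  finite subset of \<open>B\<close>, and a finite graph with the double Hall property has a 2-regular subgraph
  covering its left side: replacing each vertex and edge by a small gadget turns this into a perfect
  matching problem, and a minimal barrier in the sense of Tutte yields a set \<open>T \<subseteq> P\<close> with
  \<open>|N\<^sup>2(T)| < |T|\<close>, or \<open>|T| = 1\<close>, which is excluded because any two vertices of \<open>P\<close> have two common
  neighbours. Starting from this finite subgraph, each other \<open>a \<in> A\<close> is given degree 2 in turn by
  adding paths \<open>a b w\<close> with \<open>b\<close> and \<open>w\<close> unused, which exist since \<open>a\<close> is not pseudo-isolated.
\<close>

section \<open>Tutte's 1-factor theorem\<close>

text \<open>A matching is an involution sending each vertex to its partner. Fixed points are ruled
  out through irreflexivity of \<open>E\<close>.\<close>

definition perfect_matching :: "'v set \<Rightarrow> ('v \<Rightarrow> 'v \<Rightarrow> bool) \<Rightarrow> ('v \<Rightarrow> 'v) \<Rightarrow> bool" where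
  "perfect_matching V E f \<longleftrightarrow> (\<forall>v\<in>V. f v \<in> V \<and> f (f v) = v \<and> E v (f v))"

text \<open>The parts in \<open>\<K>\<close> may be unions of components of the graph on
  \<open>V - X\<close>. This lets parts be merged later without recomputing components.\<close>

definition barrier :: "'v set \<Rightarrow> ('v \<Rightarrow> 'v \<Rightarrow> bool) \<Rightarrow> 'v set \<Rightarrow> 'v set set \<Rightarrow> bool" where
  "barrier V E X \<K> \<longleftrightarrow> X \<subseteq> V \<and> partition_on (V - X) \<K> \<and>
     (\<forall>K\<in>\<K>. \<forall>L\<in>\<K>. \<forall>u\<in>K. \<forall>v\<in>L. E u v \<longrightarrow> K = L) \<and>
     card X < card {K \<in> \<K>. odd (card K)}"

lemma barrier_antimono:
  assumes "barrier V E' X \<K>" and "\<And>u v. E u v \<Longrightarrow> E' u v"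
  shows "barrier V E X \<K>"
  using assms unfolding barrier_def by blast

lemma perfect_matching_Union:
  assumes disj: "disjoint \<P>" and pm: "\<And>K. K \<in> \<P> \<Longrightarrow> \<exists>f. perfect_matching K E f"
  shows "\<exists>f. perfect_matching (\<Union>\<P>) E f"
proof -
  obtain F where F: "\<And>K. K \<in> \<P> \<Longrightarrow> perfect_matching K E (F K)"
    using pm by metis
  define h where "h v = F (THE K. K \<in> \<P> \<and> v \<in> K) v" for v
  have h: "h v = F K v" if "K \<in> \<P>" "v \<in> K" for K v
  proof -
    have "(THE K. K \<in> \<P> \<and> v \<in> K) = K"
      using that disj by (intro the_equality) (auto simp: disjoint_def)
    then show ?thesis by (simp add: h_def)
  qed
  have "perfect_matching (\<Union>\<P>) E h"
    using F h unfolding perfect_matching_def by (metis UnionE UnionI)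
  then show ?thesis by blast
qed

lemma perfect_matching_complete:
  assumes "finite K" and "even (card K)"
    and "\<And>u v. u \<in> K \<Longrightarrow> v \<in> K \<Longrightarrow> u \<noteq> v \<Longrightarrow> E u v"
  shows "\<exists>f. perfect_matching K E f"
  using assms
proof (induction "card K" arbitrary: K rule: less_induct)
  case less
  show ?case
  proof (cases "K = {}")
    case True
    then show ?thesis by (auto simp: perfect_matching_def)
  next
    case False
    then obtain x where x: "x \<in> K" by blast
    have "K - {x} \<noteq> {}"
      using less.prems(1,2) x by (metis One_nat_def card.empty card_Suc_Diff1 odd_one)
    then obtain y where y: "y \<in> K" "y \<noteq> x" by blast
    let ?L = "K - {x, y}"
    have card: "card ?L = card K - 2" "card K \<ge> 2"
      using less.prems(1) x y card_mono[of K "{x, y}"] by (auto simp: card_Diff_subset)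
    have "\<exists>f. perfect_matching ?L E f"
      by (rule less.hyps) (use card less.prems in auto)
    moreover have "perfect_matching {x, y} E (\<lambda>v. if v = x then y else x)"
      using x y less.prems(3) by (auto simp: perfect_matching_def)
    ultimately have "\<exists>f. perfect_matching (\<Union>{?L, {x, y}}) E f"
      by (intro perfect_matching_Union) (auto simp: disjoint_def)
    moreover have "\<Union>{?L, {x, y}} = K" using x y by auto
    ultimately show ?thesis by metis
  qed
qed

text \<open>In the union of the two matchings, follow the alternating path from \<open>d\<close>: either it closes up
  without meeting \<open>a\<close> and \<open>c\<close>, or its initial segment up to \<open>a\<close> (or \<open>c\<close>) can be rerouted
  through \<open>a b\<close> (or \<open>c b\<close>).\<close>

lemma alternating_path_exchange:
  fixes f g :: "'v \<Rightarrow> 'v"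
  assumes sym: "symp E"
    and f: "\<And>v. v \<in> V \<Longrightarrow> f v \<in> V \<and> f (f v) = v \<and> f v \<noteq> v"
    and g: "\<And>v. v \<in> V \<Longrightarrow> g v \<in> V \<and> g (g v) = v \<and> g v \<noteq> v"
    and fE: "\<And>v. v \<in> V \<Longrightarrow> v \<noteq> a \<Longrightarrow> v \<noteq> c \<Longrightarrow> E v (f v)"
    and gE: "\<And>v. v \<in> V \<Longrightarrow> v \<noteq> b \<Longrightarrow> v \<noteq> d \<Longrightarrow> E v (g v)"
    and fac: "f a = c" "f c = a" and gbd: "g b = d" "g d = b"
    and V: "a \<in> V" "b \<in> V" "c \<in> V" "d \<in> V" and ab: "E a b"
    and x: "\<And>i. x i = ((\<lambda>v. g (f v)) ^^ i) d"
    and k: "x k = a" and least: "\<And>i. i < k \<Longrightarrow> x i \<noteq> a \<and> x i \<noteq> c" and "d \<noteq> a"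
  shows "\<exists>h. perfect_matching V E h"
proof -
  have x0: "x 0 = d" and xS: "x (Suc i) = g (f (x i))" for i by (simp_all add: x)
  have xV: "x i \<in> V" for i by (induction i) (use f g V x0 xS in auto)
  have gS: "g (x (Suc i)) = f (x i)" for i using f g xV by (simp add: xS)
  have "k > 0" using k x0 \<open>d \<noteq> a\<close> by (cases k) auto
  \<comment> \<open>\<open>Z\<close> is the alternating path
    \<open>d, f d, x 1, f (x 1), ...\<close> stopped just before \<open>a\<close>. It is closed
    under \<open>f\<close>, and \<open>g\<close> leaves it only at its two ends, to \<open>b\<close>
    and to \<open>a\<close>.\<close>
  define Z where "Z = x ` {..<k} \<union> f ` x ` {..<k}"
  have fZ: "f v \<in> Z" if "v \<in> Z" for v using that f xV by (auto simp: Z_def)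
  have aZ: "a \<notin> Z" and cZ: "c \<notin> Z"
    using least f xV fac by (auto simp: Z_def) (metis lessThan_iff)+
  have dZ: "d \<in> Z" using \<open>k > 0\<close> x0 by (force simp: Z_def)
  have ga: "g a \<in> Z"
    using \<open>k > 0\<close> gS[of "k - 1"] k by (auto simp: Z_def)
  have gZ: "g v \<in> insert a (insert b Z)" if "v \<in> Z" for v
  proof -
    consider i where "i < k" "v = x i" | i where "i < k" "v = f (x i)"
      using \<open>v \<in> Z\<close> by (auto simp: Z_def)
    then show ?thesis
    proof cases
      case 1
      then show ?thesis by (cases i) (auto simp: x0 gbd gS Z_def)
    next
      case 2
      then have "g v = x (Suc i)" by (simp add: xS)
      moreover have "Suc i < k \<or> Suc i = k" using 2 by auto
      ultimately show ?thesis using k by (auto simp: Z_def)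
    qed
  qed
  \<comment> \<open>If \<open>b = f (x i)\<close>, the path is back at \<open>d\<close> after
    \<open>i + 1\<close> rounds, so by periodicity it meets \<open>a\<close> before index
    \<open>k\<close>.\<close>
  have b1: "b \<noteq> f (x i)" if "i < k" for i
  proof
    assume "b = f (x i)"
    then have per: "x (Suc i) = x 0" using xS gbd x0 by simp
    have "x (j + Suc i) = x j" for j
      using per by (induction j) (simp_all add: xS)
    from this[of "k - Suc i"] have "x (k - Suc i) = a" using that k by simp
    then show False using least[of "k - Suc i"] that by simp
  qed
  \<comment> \<open>If \<open>b = x i\<close>, then \<open>g\<close> joins the two ends
    \<open>x i\<close> and \<open>x 0\<close>. The path then reads the same backwards, and its
    middle would be a fixed point of \<open>g\<close> or of \<open>f\<close>.\<close>
  have b2: "b \<noteq> x i" for i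
  proof
    assume "b = x i"
    have refl: "g (x (i - j)) = x j" if "j \<le> i" for j
      using that
    proof (induction j)
      case 0
      then show ?case using \<open>b = x i\<close> gbd x0 by simp
    next
      case (Suc j)
      then have "i - j = Suc (i - Suc j)" by simp
      then have "f (x (i - Suc j)) = x j" using Suc gS by simp
      then have "x (i - Suc j) = f (x j)" using f xV by metis
      then show ?case using xS by simp
    qed
    show False
    proof (cases "even i")
      case True
      then obtain j where "i = j + j" by (metis evenE mult_2)
      then have "g (x j) = x j" using refl[of j] by simp
      then show False using g xV by blast
    next
      case False
      then obtain j where "i = Suc (j + j)" by (metis oddE mult_2 Suc_eq_plus1)
      then have "f (x j) = x j" using refl[of j] gS by (simp add: Suc_diff_le)
      then show False using f xV by blast
    qed
  qed
  have bZ: "b \<notin> Z" using b1 b2 by (auto simp: Z_def)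
  have "a \<noteq> b" using b2 k by auto
  \<comment> \<open>Neither auxiliary edge survives: \<open>a\<close> and \<open>c\<close> lie
    outside \<open>Z\<close>, where \<open>f\<close> is not applied, while \<open>d\<close> lies in
    \<open>Z\<close> and \<open>b\<close> is matched to \<open>a\<close>.\<close>
  define h where "h v = (if v \<in> Z then f v else if v = a then b else if v = b then a else g v)" for v
  have "h v \<in> V \<and> h (h v) = v \<and> E v (h v)" if v: "v \<in> V" for v
  proof -
    consider "v \<in> Z" | "v = a" | "v = b" | "v \<notin> Z" "v \<noteq> a" "v \<noteq> b" by blast
    then show ?thesis
    proof cases
      case 1
      then have "h v = f v" "h (f v) = f (f v)" "v \<noteq> a" "v \<noteq> c"
        using fZ aZ cZ by (auto simp: h_def)
      then show ?thesis using f[OF v] fE[OF v] by simp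
    next
      case 2
      then show ?thesis using V ab aZ bZ unfolding h_def by auto
    next
      case 3
      then show ?thesis using V ab aZ bZ \<open>a \<noteq> b\<close> sym unfolding h_def by (auto dest: sympD)
    next
      case 4
      have gg: "g (g v) = v" using g v by blast
      have "g v \<noteq> a" using ga 4 gg by metis
      moreover have "g v \<noteq> b" using gbd 4 gg dZ by metis
      moreover have "g v \<notin> Z" using gZ[of "g v"] 4 gg by auto
      moreover have "v \<noteq> d" using 4 dZ by auto
      ultimately show ?thesis using 4 gg g gE v unfolding h_def by auto
    qed
  qed
  then show ?thesis unfolding perfect_matching_def by blast
qed

text \<open>This is the exchange step of Tutte's theorem: the non-edges \<open>a c\<close> and
  \<open>b d\<close> can be traded for one of the edges \<open>a b\<close>, \<open>b c\<close>, or
  for nothing at all. Only the case where \<open>f\<close> uses \<open>a c\<close> and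
  \<open>g\<close> uses \<open>b d\<close> needs work; there the alternating path from
  \<open>d\<close> decides.\<close>

lemma perfect_matching_exchange:
  assumes fin: "finite V" and sym: "symp E" and irr: "irreflp E"
    and V: "a \<in> V" "b \<in> V" "c \<in> V" "d \<in> V" and ab: "E a b" and bc: "E b c"
    and ne: "a \<noteq> c" "b \<noteq> d" "d \<noteq> a" "d \<noteq> c"
    and pf: "perfect_matching V (\<lambda>u v. E u v \<or> {u, v} = {a, c}) f"
    and pg: "perfect_matching V (\<lambda>u v. E u v \<or> {u, v} = {b, d}) g"
  shows "\<exists>h. perfect_matching V E h"
proof (cases "f a = c \<and> g b = d")
  case False
  then have "perfect_matching V E f \<or> perfect_matching V E g"
    using pf pg V unfolding perfect_matching_def by (metis doubleton_eq_iff)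
  then show ?thesis by blast
next
  case True
  then have fac: "f a = c" "f c = a" and gbd: "g b = d" "g d = b"
    using pf pg V unfolding perfect_matching_def by auto
  have f: "f v \<in> V \<and> f (f v) = v \<and> f v \<noteq> v" if "v \<in> V" for v
    using pf that irr ne unfolding perfect_matching_def irreflp_def
    by (metis doubleton_eq_iff)
  have g: "g v \<in> V \<and> g (g v) = v \<and> g v \<noteq> v" if "v \<in> V" for v
    using pg that irr ne unfolding perfect_matching_def irreflp_def
    by (metis doubleton_eq_iff)
  have fE: "E v (f v)" if "v \<in> V" "v \<noteq> a" "v \<noteq> c" for v
    using pf that unfolding perfect_matching_def by (metis doubleton_eq_iff)
  have gE: "E v (g v)" if "v \<in> V" "v \<noteq> b" "v \<noteq> d" for v
    using pg that unfolding perfect_matching_def by (metis doubleton_eq_iff)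
  define x where "x i = ((\<lambda>v. g (f v)) ^^ i) d" for i
  have x0: "x 0 = d" and xS: "x (Suc i) = g (f (x i))" for i by (simp_all add: x_def)
  have xV: "x i \<in> V" for i by (induction i) (use f g V x0 xS in auto)
  show ?thesis
  proof (cases "\<exists>i. x i = a \<or> x i = c")
    case True
    define k where "k = (LEAST i. x i = a \<or> x i = c)"
    have k: "x k = a \<or> x k = c" unfolding k_def using LeastI_ex[OF True] .
    have least: "x i \<noteq> a \<and> x i \<noteq> c" if "i < k" for i
      using that not_less_Least unfolding k_def by blast
    from k show ?thesis
    proof
      assume "x k = a"
      show ?thesis
        by (rule alternating_path_exchange[OF sym f g fE gE fac gbd V ab x_def \<open>x k = a\<close> least])
          (use ne in auto)
    next
      assume "x k = c"
      \<comment> \<open>The situation is symmetric in \<open>a\<close> and \<open>c\<close>; the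
        path is now rerouted through \<open>c b\<close>.\<close>
      show ?thesis
        by (rule alternating_path_exchange[OF sym f g _ gE fac(2,1) gbd V(3,2,1,4)
              sympD[OF sym bc] x_def \<open>x k = c\<close>])
          (use least ne fE in auto)
    qed
  next
    case False
    \<comment> \<open>The path never meets \<open>a\<close> or \<open>c\<close>, so it closes up to
      an alternating cycle \<open>Y\<close> through the edge \<open>b d\<close>. Taking
      \<open>f\<close> on \<open>Y\<close> and \<open>g\<close> elsewhere avoids both auxiliary
      edges.\<close>
    define Y where "Y = range x \<union> f ` range x"
    have "\<not> inj x"
      using fin xV by (metis finite_subset image_subset_iff infinite_UNIV_char_0 finite_imageD)
    \<comment> \<open>A repetition \<open>x i = x j\<close> can be pulled back to the start, as
      \<open>f\<close> and \<open>g\<close> are injective on \<open>V\<close>. Hence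
      \<open>d\<close> also has a predecessor on the path.\<close>
    have per: "\<exists>n. x (Suc n) = d"
    proof -
      obtain i m where "x i = x (i + Suc m)"
        using \<open>\<not> inj x\<close> unfolding inj_def
        by (metis less_iff_Suc_add linorder_neqE_nat add_Suc_right)
      moreover have "x j = x (j + Suc m) \<Longrightarrow> x 0 = x (Suc m)" for j
      proof (induction j)
        case (Suc j)
        then have "f (x j) = f (x (j + Suc m))" using g f xV xS by (metis add_Suc)
        then have "x j = x (j + Suc m)" using f xV by metis
        then show ?case by (rule Suc.IH)
      qed simp
      ultimately show ?thesis using x0 by metis
    qed
    have fY: "f v \<in> Y" if "v \<in> Y" for v using that f xV by (auto simp: Y_def)
    have gY: "g v \<in> Y" if "v \<in> Y" for v
    proof -
      consider i where "v = x i" | i where "v = f (x i)"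
        using \<open>v \<in> Y\<close> by (auto simp: Y_def)
      then show ?thesis
      proof cases
        case 1
        have "\<exists>j. v = x (Suc j)" using 1 per x0 by (metis not0_implies_Suc)
        then obtain j where "v = g (f (x j))" using xS by blast
        then have "g v = f (x j)" using g f xV by metis
        then show ?thesis by (simp add: Y_def)
      next
        case 2
        then have "g v = x (Suc i)" by (simp add: xS)
        then show ?thesis by (simp add: Y_def)
      qed
    qed
    have "f (x i) \<noteq> a" "f (x i) \<noteq> c" for i
      using False f[OF xV, of i] fac by metis+
    then have acY: "a \<notin> Y" "c \<notin> Y" using False by (auto simp: Y_def)
    have bdY: "d \<in> Y" "b \<in> Y" using x0 gY[of d] gbd by (auto simp: Y_def)
    have "perfect_matching V E (\<lambda>v. if v \<in> Y then f v else g v)"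
      unfolding perfect_matching_def using f g fE gE fY gY acY bdY by (auto; metis)
    then show ?thesis by blast
  qed
qed

text \<open>Give each odd clique its own vertex of \<open>X\<close>, so that all cliques become
  even. The rest of \<open>X\<close> is complete, and it is even because \<open>card V\<close>
  is.\<close>

lemma perfect_matching_of_cliques:
  assumes fin: "finite V" and even: "even (card V)"
    and X: "X \<subseteq> V" "\<And>x v. x \<in> X \<Longrightarrow> v \<in> V \<Longrightarrow> x \<noteq> v \<Longrightarrow> E x v \<and> E v x"
    and part: "partition_on (V - X) \<K>"
    and clique: "\<And>K u v. K \<in> \<K> \<Longrightarrow> u \<in> K \<Longrightarrow> v \<in> K \<Longrightarrow> u \<noteq> v \<Longrightarrow> E u v"
    and card: "card {K \<in> \<K>. odd (card K)} \<le> card X"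
  shows "\<exists>f. perfect_matching V E f"
proof -
  let ?O = "{K \<in> \<K>. odd (card K)}"
  have finX: "finite X" and finK: "finite \<K>"
    using fin X part finite_subset finite_elements by (metis, metis finite_Diff)
  have un: "\<Union>\<K> = V - X" and dj: "disjoint \<K>"
    using part by (auto simp: partition_on_def)
  have sub: "K \<subseteq> V - X" if "K \<in> \<K>" for K using un that by blast
  have finE: "finite K" if "K \<in> \<K>" for K using sub[OF that] fin by (meson finite_Diff finite_subset)
  have "finite ?O" using finK by simp
  then obtain \<phi> where \<phi>: "inj_on \<phi> ?O" "\<phi> ` ?O \<subseteq> X"
    using card_le_inj[OF _ finX card] by blast
  define Q where "Q K = (if odd (card K) then insert (\<phi> K) K else K)" for K
  define R where "R = X - \<phi> ` ?O"
  have \<phi>X: "\<phi> K \<in> X" if "K \<in> \<K>" "odd (card K)" for K using \<phi> that by blast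
  have union: "\<Union>(insert R (Q ` \<K>)) = V"
  proof -
    have "\<Union>(Q ` \<K>) = \<Union>\<K> \<union> \<phi> ` ?O" by (auto simp: Q_def split: if_splits)
    then show ?thesis using un X(1) \<phi>(2) by (auto simp: R_def)
  qed
  have Qdisj: "Q K \<inter> Q L = {}" if "K \<in> \<K>" "L \<in> \<K>" "K \<noteq> L" for K L
  proof -
    have "K \<inter> L = {}" using dj that by (auto simp: disjoint_def)
    moreover have "odd (card K) \<Longrightarrow> odd (card L) \<Longrightarrow> \<phi> K \<noteq> \<phi> L"
      using \<phi>(1) that by (auto simp: inj_on_def)
    ultimately show ?thesis
      using sub[OF that(1)] sub[OF that(2)] \<phi>X that by (auto simp: Q_def)
  qed
  have RQ: "R \<inter> Q K = {}" if "K \<in> \<K>" for K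
    using sub[OF that] that by (auto simp: Q_def R_def)
  have disj: "disjoint (insert R (Q ` \<K>))"
    using Qdisj RQ unfolding disjoint_def by blast
  have evenQ: "even (card (Q K))" if "K \<in> \<K>" for K
  proof (cases "odd (card K)")
    case True
    then have "\<phi> K \<notin> K" using sub[OF that] \<phi>X[OF that] by blast
    then show ?thesis using True finE[OF that] by (simp add: Q_def)
  qed (simp add: Q_def)
  have finQ: "finite (Q K)" if "K \<in> \<K>" for K using finE[OF that] by (simp add: Q_def)
  have evenR: "even (card R)"
  proof -
    have "card (\<Union>(Q ` \<K>)) = (\<Sum>K\<in>\<K>. card (Q K))"
      using finK finQ Qdisj by (intro card_UN_disjoint) auto
    then have "even (card (\<Union>(Q ` \<K>)))" using evenQ by (simp add: dvd_sum)
    moreover have "card V = card R + card (\<Union>(Q ` \<K>))"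
      using union RQ finX finK finQ
      by (subst card_Un_disjoint[symmetric]) (auto simp: R_def)
    ultimately show ?thesis using even by simp
  qed
  have pm: "\<exists>f. perfect_matching K E f" if "K \<in> insert R (Q ` \<K>)" for K
  proof (rule perfect_matching_complete)
    have "K \<subseteq> V" using that union by blast
    then show "finite K" using fin finite_subset by blast
    show "even (card K)" using that evenR evenQ by auto
    show "E u v" if uv: "u \<in> K" "v \<in> K" "u \<noteq> v" for u v
    proof (cases "u \<in> X \<or> v \<in> X")
      case True
      then show ?thesis using X(2) uv \<open>K \<subseteq> V\<close> by blast
    next
      case False
      then obtain L where "L \<in> \<K>" "K = Q L"
        using \<open>K \<in> insert R (Q ` \<K>)\<close> uv by (auto simp: R_def)
      moreover then have "u \<in> L" "v \<in> L"
        using False uv \<phi>X by (auto simp: Q_def split: if_splits)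
      ultimately show ?thesis using clique uv by blast
    qed
  qed
  show ?thesis using perfect_matching_Union[OF disj pm] union by simp
qed

text \<open>Tutte's 1-factor theorem. Adding edges preserves the absence of barriers, so one may
  assume that every additional edge creates a perfect matching.\<close>

theorem perfect_matching_or_barrier:
  assumes fin: "finite V" and "symp E" and "irreflp E"
  shows "(\<exists>f. perfect_matching V E f) \<or> (\<exists>X \<K>. barrier V E X \<K>)"
  using assms(2,3)
proof (induction "card {(u, v) \<in> V \<times> V. \<not> E u v}" arbitrary: E rule: less_induct)
  case less
  note sym = \<open>symp E\<close> and irr = \<open>irreflp E\<close>
  \<comment> \<open>If adjacency is transitive outside \<open>X\<close>, the classes there are
    cliques, and either counting gives a barrier or \<open>perfect_matching_of_cliques\<close>
    applies.\<close>
  define X where "X = {x \<in> V. \<forall>v\<in>V. v \<noteq> x \<longrightarrow> E x v}"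
  have XV: "X \<subseteq> V" by (auto simp: X_def)
  show ?case
  proof (cases "\<forall>u\<in>V - X. \<forall>v\<in>V - X. \<forall>w\<in>V - X. E u v \<longrightarrow> E v w \<longrightarrow> u \<noteq> w \<longrightarrow> E u w")
    case True
    define r where "r = {(u, v). u \<in> V - X \<and> v \<in> V - X \<and> (u = v \<or> E u v)}"
    have "equiv (V - X) r"
      unfolding equiv_def refl_on_def sym_def trans_def r_def
      using sympD[OF sym] True by blast
    then have part: "partition_on (V - X) ((V - X) // r)" by (rule partition_on_quotient)
    have cls: "(u, v) \<in> r" if "K \<in> (V - X) // r" "u \<in> K" "v \<in> K" for K u v
      using that \<open>equiv (V - X) r\<close> by (meson quotient_eq_iff)
    have noedge: "K = L" if "K \<in> (V - X) // r" "L \<in> (V - X) // r" "u \<in> K" "v \<in> L" "E u v" for K L u v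
    proof -
      have "u \<in> V - X" "v \<in> V - X"
        using that part by (auto simp: partition_on_def)
      then have "(u, v) \<in> r" using that by (simp add: r_def)
      then show ?thesis using that \<open>equiv (V - X) r\<close> by (meson quotient_eq_iff)
    qed
    consider "card X < card {K \<in> (V - X) // r. odd (card K)}" | "odd (card V)"
      | "card {K \<in> (V - X) // r. odd (card K)} \<le> card X" "even (card V)" by linarith
    then show ?thesis
    proof cases
      case 1
      then have "barrier V E X ((V - X) // r)"
        unfolding barrier_def using XV part noedge by blast
      then show ?thesis by blast
    next
      case 2
      then have "{K \<in> {V}. odd (card K)} = {V}" "V \<noteq> {}" by auto
      then have "barrier V E {} {V}" by (auto simp: barrier_def partition_on_def)
      then show ?thesis by blast
    next
      case 3
      have "\<exists>f. perfect_matching V E f"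
      proof (rule perfect_matching_of_cliques[OF fin 3(2) XV _ part _ 3(1)])
        show "E x v \<and> E v x" if "x \<in> X" "v \<in> V" "x \<noteq> v" for x v
          using that sympD[OF sym] by (auto simp: X_def)
        show "E u v" if "K \<in> (V - X) // r" "u \<in> K" "v \<in> K" "u \<noteq> v" for K u v
          using cls[OF that(1-3)] that(4) by (auto simp: r_def)
      qed
      then show ?thesis by blast
    qed
  next
    case False
    \<comment> \<open>Failure of transitivity gives a path \<open>a b c\<close> with
      \<open>a c\<close> missing, and \<open>b\<close> outside \<open>X\<close> has some
      non-neighbour \<open>d\<close>. Adding \<open>a c\<close>, or adding \<open>b d\<close>,
      leaves fewer non-edges, so the induction hypothesis applies to both graphs.\<close>
    then obtain a b c where abc: "a \<in> V" "b \<in> V" "b \<notin> X" "c \<in> V"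
      "E a b" "E b c" "a \<noteq> c" "\<not> E a c" by blast
    then obtain d where d: "d \<in> V" "d \<noteq> b" "\<not> E b d" by (auto simp: X_def)
    have ne: "d \<noteq> a" "d \<noteq> c" using abc d sympD[OF sym] by auto
    have add: "(\<exists>f. perfect_matching V (\<lambda>u v. E u v \<or> {u, v} = {p, q}) f) \<or> (\<exists>X \<K>. barrier V E X \<K>)"
      if "p \<in> V" "q \<in> V" "p \<noteq> q" "\<not> E p q" for p q
    proof -
      let ?E = "\<lambda>u v. E u v \<or> {u, v} = {p, q}"
      have "{(u, v) \<in> V \<times> V. \<not> ?E u v} \<subset> {(u, v) \<in> V \<times> V. \<not> E u v}"
        using that by auto
      then have "card {(u, v) \<in> V \<times> V. \<not> ?E u v} < card {(u, v) \<in> V \<times> V. \<not> E u v}"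
        using fin by (intro psubset_card_mono) (auto intro: finite_subset[of _ "V \<times> V"])
      moreover have "symp ?E" using sym by (auto simp: symp_def doubleton_eq_iff)
      moreover have "irreflp ?E" using irr that by (auto simp: irreflp_def doubleton_eq_iff)
      ultimately have "(\<exists>f. perfect_matching V ?E f) \<or> (\<exists>X \<K>. barrier V ?E X \<K>)"
        by (rule less.hyps)
      then show ?thesis using barrier_antimono[of V ?E _ _ E] by blast
    qed
    show ?thesis
      using add[of a c] add[of b d] abc d ne
        perfect_matching_exchange[OF fin sym irr abc(1,2,4) d(1) abc(5-7) d(2)[symmetric] ne]
      by blast
  qed
qed

section \<open>Minimal barriers\<close>

text \<open>If \<open>x\<close> touched at most two parts, it could be moved out of \<open>X\<close>
  and merged with them. By parity the number of odd parts drops by at most one, as does the size of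
  \<open>X\<close>, so a smaller barrier would result.\<close>

lemma minimal_barrier_touches_three:
  assumes fin: "finite V" and sym: "symp E" and bar: "barrier V E X \<K>"
    and min: "\<And>X' \<K>'. barrier V E X' \<K>' \<Longrightarrow> card X \<le> card X'" and x: "x \<in> X"
  shows "3 \<le> card {K \<in> \<K>. \<exists>y\<in>K. E x y}"
proof (rule ccontr)
  define N where "N = {K \<in> \<K>. \<exists>y\<in>K. E x y}"
  assume "\<not> ?thesis"
  then have N2: "card N \<le> 2" by (simp add: N_def)
  have XV: "X \<subseteq> V" and part: "partition_on (V - X) \<K>"
    and noedge: "\<And>K L u v. K \<in> \<K> \<Longrightarrow> L \<in> \<K> \<Longrightarrow> u \<in> K \<Longrightarrow> v \<in> L \<Longrightarrow> E u v \<Longrightarrow> K = L"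
    and odd: "card X < card {K \<in> \<K>. odd (card K)}"
    using bar unfolding barrier_def by blast+
  have un: "\<Union>\<K> = V - X" and dj: "disjoint \<K>" and ne: "{} \<notin> \<K>"
    using part by (auto simp: partition_on_def)
  have finX: "finite X" and finK: "finite \<K>"
    using fin XV part finite_subset finite_elements by (metis, metis finite_Diff)
  have finE: "finite K" if "K \<in> \<K>" for K
    using un that fin by (metis Union_upper finite_Diff finite_subset)
  define L where "L = insert x (\<Union>N)"
  define \<K>' where "\<K>' = insert L (\<K> - N)"
  have xun: "x \<notin> \<Union>\<K>" using un x by blast
  have NK: "N \<subseteq> \<K>" by (auto simp: N_def)
  have LK: "L \<notin> \<K>" using xun by (auto simp: L_def)
  have "partition_on (V - (X - {x})) \<K>'"
  proof (rule partition_onI)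
    show "\<Union>\<K>' = V - (X - {x})"
    proof -
      have "\<Union>\<K>' = insert x (\<Union>\<K>)" using NK by (auto simp: \<K>'_def L_def)
      then show ?thesis using un x XV by auto
    qed
    show "disjnt p q" if "p \<in> \<K>'" "q \<in> \<K>'" "p \<noteq> q" for p q
    proof -
      have djK: "K \<inter> K' = {}" if "K \<in> \<K>" "K' \<in> \<K>" "K \<noteq> K'" for K K'
        using dj that by (auto simp: disjoint_def)
      have "L \<inter> K = {}" if "K \<in> \<K> - N" for K
        using that xun NK djK[of K] unfolding L_def by blast
      then show ?thesis using that djK unfolding \<K>'_def disjnt_def by blast
    qed
    show "{} \<notin> \<K>'"
      using ne by (auto simp: \<K>'_def L_def)
  qed
  moreover have "P = Q" if "P \<in> \<K>'" "Q \<in> \<K>'" "u \<in> P" "v \<in> Q" "E u v" for P Q u v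
  proof -
    have far: "K \<in> \<K> - N \<Longrightarrow> y \<in> K \<Longrightarrow> u' \<in> L \<Longrightarrow> \<not> E u' y" for K y u'
      using noedge NK unfolding L_def N_def by blast
    show ?thesis
      using that far[of P u v] far[of Q v u] noedge sympD[OF sym \<open>E u v\<close>] unfolding \<K>'_def by blast
  qed
  moreover have "card (X - {x}) < card {K \<in> \<K>'. odd (card K)}"
  proof -
    define ON where "ON = {K \<in> N. odd (card K)}"
    define OR where "OR = {K \<in> \<K> - N. odd (card K)}"
    have finN: "finite N" using NK finK finite_subset by blast
    have split: "card {K \<in> \<K>. odd (card K)} = card ON + card OR"
      using finN finK NK unfolding ON_def OR_def
      by (subst card_Un_disjoint[symmetric]) (auto intro: arg_cong[where f = card])
    have "card ON \<le> card N" unfolding ON_def using finN by (auto intro: card_mono)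
    have cardL: "card L = Suc (\<Sum>K\<in>N. card K)"
    proof -
      have "card (\<Union>N) = (\<Sum>K\<in>N. card K)"
        using dj NK finE unfolding disjoint_def by (intro card_Union_disjoint) (auto simp: pairwise_def disjnt_def)
      moreover have "finite (\<Union>N)" using finN finE NK by blast
      moreover have "x \<notin> \<Union>N" using xun NK by blast
      ultimately show ?thesis by (simp add: L_def)
    qed
    \<comment> \<open>With two odd parts touched, the merged part is odd as well, because
      \<open>x\<close> itself counts; so even then only one odd part is lost.\<close>
    have parity: "odd (card L) \<longleftrightarrow> even (card ON)"
      using finN by (simp add: cardL even_sum_iff ON_def)
    show ?thesis
    proof (cases "even (card ON)")
      case True
      then have "{K \<in> \<K>'. odd (card K)} = insert L OR"
        using parity by (auto simp: \<K>'_def OR_def)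
      moreover have "L \<notin> OR" "finite OR" using LK finK by (auto simp: OR_def)
      ultimately have "card {K \<in> \<K>'. odd (card K)} = Suc (card OR)" by simp
      then show ?thesis
        using split odd x finX N2 \<open>card ON \<le> card N\<close> by simp
    next
      case False
      then have "{K \<in> \<K>'. odd (card K)} = OR"
        using parity by (auto simp: \<K>'_def OR_def)
      moreover have "card ON \<le> 1"
        using False N2 \<open>card ON \<le> card N\<close> by (cases "card ON = 2") auto
      ultimately show ?thesis
        using split odd card.remove[OF finX x] by simp
    qed
  qed
  ultimately have "barrier V E (X - {x}) \<K>'"
    unfolding barrier_def using XV by blast
  then have "card X \<le> card (X - {x})" by (rule min)
  then show False using x finX by (metis card_Diff1_less not_less)
qed

section \<open>Finite graphs with the double Hall property\<close>

text \<open>A perfect matching of the gadget graph selects the edges \<open>(p, b)\<close> for which \<open>EP p b\<close> and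
  \<open>EB p b\<close> are not matched to each other. The copies \<open>PV p False\<close>, \<open>PV p True\<close> select exactly two
  edges at \<open>p\<close>; since \<open>BV b False\<close> and \<open>BV b True\<close> are adjacent, either none or two edges are
  selected at \<open>b\<close>.\<close>

datatype ('p, 'b) gadget = PV 'p bool | EP 'p 'b | EB 'p 'b | BV 'b bool

fun gadget_adj :: "('p, 'b) gadget \<Rightarrow> ('p, 'b) gadget \<Rightarrow> bool" where
  "gadget_adj (PV p i) (EP q b) \<longleftrightarrow> p = q"
| "gadget_adj (EP q b) (PV p i) \<longleftrightarrow> p = q"
| "gadget_adj (EP p b) (EB q c) \<longleftrightarrow> p = q \<and> b = c"
| "gadget_adj (EB q c) (EP p b) \<longleftrightarrow> p = q \<and> b = c"
| "gadget_adj (EB p b) (BV c i) \<longleftrightarrow> b = c"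
| "gadget_adj (BV c i) (EB p b) \<longleftrightarrow> b = c"
| "gadget_adj (BV b i) (BV c j) \<longleftrightarrow> b = c \<and> i \<noteq> j"
| "gadget_adj _ _ \<longleftrightarrow> False"

definition gadget_vertices :: "'p set \<Rightarrow> 'b set \<Rightarrow> ('p \<times> 'b) set \<Rightarrow> ('p, 'b) gadget set" where
  "gadget_vertices P B R = (\<lambda>(p, i). PV p i) ` (P \<times> UNIV) \<union> (\<lambda>(p, b). EP p b) ` R \<union>
     (\<lambda>(p, b). EB p b) ` R \<union> (\<lambda>(b, i). BV b i) ` (B \<times> UNIV)"

section \<open>Matchings of the gadget graph\<close>

lemma gadget_adj_iff:
  "gadget_adj (PV p i) y \<longleftrightarrow> (\<exists>b. y = EP p b)"
  "gadget_adj (EP p b) y \<longleftrightarrow> y = EB p b \<or> y = PV p False \<or> y = PV p True"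
  "gadget_adj (EB p b) y \<longleftrightarrow> y = EP p b \<or> y = BV b False \<or> y = BV b True"
  "gadget_adj (BV b i) y \<longleftrightarrow> y = BV b (\<not> i) \<or> (\<exists>p. y = EB p b)"
  by (cases y; auto)+

lemma symp_gadget_adj: "symp gadget_adj"
  by (rule sympI, erule gadget_adj.elims) auto

lemma irreflp_gadget_adj: "irreflp gadget_adj"
  unfolding irreflp_def by (metis gadget.exhaust gadget_adj.simps)

lemma gadget_vertices_simps [simp]:
  "PV p i \<in> gadget_vertices P B R \<longleftrightarrow> p \<in> P"
  "EP p b \<in> gadget_vertices P B R \<longleftrightarrow> (p, b) \<in> R"
  "EB p b \<in> gadget_vertices P B R \<longleftrightarrow> (p, b) \<in> R"
  "BV b i \<in> gadget_vertices P B R \<longleftrightarrow> b \<in> B"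
  by (auto simp: gadget_vertices_def)

lemma finite_gadget_vertices:
  assumes "finite P" "finite B" "R \<subseteq> P \<times> B"
  shows "finite (gadget_vertices P B R)"
proof -
  have "finite R" using assms by (meson finite_SigmaI finite_subset)
  then show ?thesis using assms by (simp add: gadget_vertices_def)
qed

lemma two_factor_of_gadget_matching:
  assumes R: "R \<subseteq> P \<times> B" and pm: "perfect_matching (gadget_vertices P B R) gadget_adj f"
  shows "\<exists>H\<subseteq>R. (\<forall>p\<in>P. card (H `` {p}) = 2) \<and> (\<forall>b. H\<inverse> `` {b} = {} \<or> card (H\<inverse> `` {b}) = 2)"
proof -
  let ?V = "gadget_vertices P B R"
  have f: "f v \<in> ?V" "f (f v) = v" "gadget_adj v (f v)" if "v \<in> ?V" for v
    using pm that by (auto simp: perfect_matching_def)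
  define H where "H = {(p, b) \<in> R. f (EP p b) \<noteq> EB p b}"
  have "card (H `` {p}) = 2" if p: "p \<in> P" for p
  proof -
    have "\<exists>b. f (PV p i) = EP p b" for i
      using f(3)[of "PV p i"] p by (simp add: gadget_adj_iff)
    then obtain c where c: "f (PV p i) = EP p (c i)" for i by metis
    have fc: "f (EP p (c i)) = PV p i" for i
      using f(2)[of "PV p i"] p c by simp
    have cR: "(p, c i) \<in> R" for i using f(1)[of "PV p i"] p c by simp
    have "H `` {p} = {c False, c True}"
    proof (intro equalityI subsetI)
      fix b assume "b \<in> H `` {p}"
      then have b: "(p, b) \<in> R" "f (EP p b) \<noteq> EB p b" by (auto simp: H_def)
      then obtain i where "f (EP p b) = PV p i"
        using f(3)[of "EP p b"] by (auto simp: gadget_adj_iff)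
      then have "EP p (c i) = EP p b" using f(2)[of "EP p b"] b c by simp
      then show "b \<in> {c False, c True}" by (cases i) auto
    next
      fix b assume "b \<in> {c False, c True}"
      then show "b \<in> H `` {p}" using cR fc by (auto simp: H_def)
    qed
    moreover have "c False \<noteq> c True" using fc by (metis gadget.inject(1))
    ultimately show ?thesis by simp
  qed
  moreover have "H\<inverse> `` {b} = {} \<or> card (H\<inverse> `` {b}) = 2" for b
  proof (cases "H\<inverse> `` {b} = {}")
    case False
    have HB: "\<exists>i. f (EB p b) = BV b i" if "(p, b) \<in> H" for p
    proof -
      have "(p, b) \<in> R" "f (EP p b) \<noteq> EB p b" using that by (auto simp: H_def)
      then show ?thesis
        using f(3)[of "EB p b"] f(2)[of "EB p b"] by (auto simp: gadget_adj_iff)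
    qed
    obtain q where q: "(q, b) \<in> H" using False by blast
    then obtain j where j: "f (EB q b) = BV b j" using HB by blast
    have "b \<in> B" using q R by (auto simp: H_def)
    have fj: "f (BV b j) = EB q b" using f(2)[of "EB q b"] q j by (auto simp: H_def)
    \<comment> \<open>Once one copy of \<open>b\<close> is matched to an edge node, the other copy
      cannot be matched to it, so both copies select edges.\<close>
    have "f (BV b (\<not> j)) \<noteq> BV b j"
      using fj f(2)[of "BV b (\<not> j)"] \<open>b \<in> B\<close> by auto
    then have "\<exists>p. f (BV b i) = EB p b" for i
      using fj f(3)[of "BV b i"] \<open>b \<in> B\<close> by (cases "i = j") (auto simp: gadget_adj_iff)
    then obtain c where c: "f (BV b i) = EB (c i) b" for i by metis
    have fc: "f (EB (c i) b) = BV b i" for i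
      using f(2)[of "BV b i"] \<open>b \<in> B\<close> c by simp
    have cR: "(c i, b) \<in> R" for i using f(1)[of "BV b i"] \<open>b \<in> B\<close> c by simp
    have "H\<inverse> `` {b} = {c False, c True}"
    proof (intro equalityI subsetI)
      fix p assume "p \<in> H\<inverse> `` {b}"
      then have "(p, b) \<in> H" by simp
      then obtain i where "f (EB p b) = BV b i" using HB by blast
      then have "EB (c i) b = EB p b" using f(2)[of "EB p b"] \<open>(p, b) \<in> H\<close> c by (auto simp: H_def)
      then show "p \<in> {c False, c True}" by (cases i) auto
    next
      fix p assume "p \<in> {c False, c True}"
      then obtain i where i: "p = c i" by blast
      have "f (EP p b) \<noteq> EB p b"
      proof
        assume "f (EP p b) = EB p b"
        then have "f (EB p b) = EP p b" using f(2)[of "EP p b"] cR i by simp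
        then show False using fc i by simp
      qed
      then show "p \<in> H\<inverse> `` {b}" using cR i by (simp add: H_def)
    qed
    moreover have "c False \<noteq> c True" using fc by (metis gadget.inject(4))
    ultimately show ?thesis by simp
  qed simp
  ultimately show ?thesis by (intro exI[of _ H]) (auto simp: H_def)
qed

section \<open>Barriers of the gadget graph\<close>

lemma even_card_involution:
  assumes "finite S" and "\<And>v. v \<in> S \<Longrightarrow> \<sigma> v \<in> S \<and> \<sigma> (\<sigma> v) = v \<and> \<sigma> v \<noteq> v"
  shows "even (card S)"
  using assms
proof (induction "card S" arbitrary: S rule: less_induct)
  case less
  show ?case
  proof (cases "S = {}")
    case False
    then obtain x where x: "x \<in> S" by blast
    let ?S = "S - {x, \<sigma> x}"
    have s: "\<sigma> x \<in> S" "\<sigma> x \<noteq> x" using less.prems(2) x by auto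
    have card: "card ?S = card S - 2" "card S \<ge> 2"
      using less.prems(1) x s card_mono[of S "{x, \<sigma> x}"] by (auto simp: card_Diff_subset)
    have "\<sigma> v \<in> ?S \<and> \<sigma> (\<sigma> v) = v \<and> \<sigma> v \<noteq> v" if "v \<in> ?S" for v
      using that less.prems(2) x by (metis Diff_iff empty_iff insert_iff)
    then have "even (card ?S)"
      using less.hyps[of ?S] card less.prems(1) by simp
    then show ?thesis using card by simp
  qed simp
qed

text \<open>Minimality forces the barrier to respect the gadgets: it consists of both copies of the
  vertices in \<open>U\<close> and \<open>W\<close> and of the nodes \<open>EP p b\<close> with \<open>p \<in> T\<close>. Of the
  remaining vertices, those outside \<open>Sp\<close> pair up within their class, so the size of a class has
  the parity of the number of elements of \<open>Sp\<close> in it.\<close>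

lemma gadget_barrier_bound:
  fixes P :: "'p set" and B :: "'b set" and R :: "('p \<times> 'b) set"
  assumes fin: "finite P" "finite B" and R: "R \<subseteq> P \<times> B"
    and deg: "\<forall>p\<in>P. \<exists>b. (p, b) \<in> R"
    and bar: "barrier (gadget_vertices P B R) gadget_adj X \<K>"
    and min: "\<forall>X' \<K>'. barrier (gadget_vertices P B R) gadget_adj X' \<K>' \<longrightarrow> card X \<le> card X'"
  shows "\<exists>T U W. T \<subseteq> P \<and> U \<subseteq> B \<and> W \<subseteq> P \<and>
    card U + card W + card {b \<in> B - U. 2 \<le> card {p \<in> T. (p, b) \<in> R}} < card T \<and>
    (\<forall>t p b c. T = {t} \<longrightarrow> U = {} \<longrightarrow> W = {} \<longrightarrow> p \<noteq> t \<longrightarrow> b \<noteq> c \<longrightarrow>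
       \<not> {(t, b), (t, c), (p, b), (p, c)} \<subseteq> R)"
proof -
  let ?V = "gadget_vertices P B R"
  note finV = finite_gadget_vertices[OF fin R]
  have finR: "finite R" using fin R by (meson finite_SigmaI finite_subset)
  have XV: "X \<subseteq> ?V" and part: "partition_on (?V - X) \<K>"
    and noedge: "\<And>K L u v. K \<in> \<K> \<Longrightarrow> L \<in> \<K> \<Longrightarrow> u \<in> K \<Longrightarrow> v \<in> L \<Longrightarrow> gadget_adj u v \<Longrightarrow> K = L"
    and odd: "card X < card {K \<in> \<K>. odd (card K)}"
    using bar unfolding barrier_def by blast+
  have un: "\<Union>\<K> = ?V - X" and dj: "disjoint \<K>"
    using part by (auto simp: partition_on_def)
  have finX: "finite X" using finV XV finite_subset by blast
  have finK: "finite \<K>" using part finV finite_elements by blast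
  have finE: "finite K" if "K \<in> \<K>" for K
    using un that finV by (metis Union_upper finite_Diff finite_subset)
  have cls: "\<exists>K\<in>\<K>. y \<in> K" if "y \<in> ?V" "y \<notin> X" for y
  proof -
    have "y \<in> \<Union>\<K>" unfolding un using that by simp
    then show ?thesis by simp
  qed
  have inV: "y \<in> ?V" "y \<notin> X" if "K \<in> \<K>" "y \<in> K" for K y
  proof -
    have "y \<in> \<Union>\<K>" using that by blast
    then show "y \<in> ?V" "y \<notin> X" unfolding un by simp_all
  qed
  have same: "z \<in> K" if h: "K \<in> \<K>" "y \<in> K" "z \<in> ?V" "z \<notin> X" "gadget_adj y z" for K y z
  proof -
    obtain L where "L \<in> \<K>" "z \<in> L" using cls h(3,4) by blast
    moreover have "K = L" by (rule noedge[OF h(1) \<open>L \<in> \<K>\<close> h(2) \<open>z \<in> L\<close> h(5)])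
    ultimately show ?thesis by simp
  qed
  have three: "\<exists>y1 y2 y3. {y1, y2, y3} \<subseteq> ?V - X \<and> gadget_adj x y1 \<and> gadget_adj x y2 \<and> gadget_adj x y3 \<and>
      (\<forall>K\<in>\<K>. \<not> {y1, y2} \<subseteq> K \<and> \<not> {y1, y3} \<subseteq> K \<and> \<not> {y2, y3} \<subseteq> K)" if "x \<in> X" for x
  proof -
    have "3 \<le> card {K \<in> \<K>. \<exists>y\<in>K. gadget_adj x y}"
      by (rule minimal_barrier_touches_three[OF finV symp_gadget_adj bar min[rule_format] that])
    then obtain \<N> where "\<N> \<subseteq> {K \<in> \<K>. \<exists>y\<in>K. gadget_adj x y}" "card \<N> = 3"
      by (meson obtain_subset_with_card_n)
    moreover then obtain K1 K2 K3 where "\<N> = {K1, K2, K3}"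
      and K': "K1 \<noteq> K2" "K1 \<noteq> K3" "K2 \<noteq> K3" by (auto simp: card_3_iff)
    ultimately have K: "K1 \<in> \<K>" "K2 \<in> \<K>" "K3 \<in> \<K>"
      and "\<exists>y\<in>K1. gadget_adj x y" "\<exists>y\<in>K2. gadget_adj x y" "\<exists>y\<in>K3. gadget_adj x y"
      by simp_all
    then obtain y1 y2 y3 where y: "y1 \<in> K1" "y2 \<in> K2" "y3 \<in> K3"
      "gadget_adj x y1" "gadget_adj x y2" "gadget_adj x y3" by blast
    have uniq: "L = L'" if "L \<in> \<K>" "L' \<in> \<K>" "z \<in> L" "z \<in> L'" for L L' z
      using dj that by (auto simp: disjoint_def)
    have "\<forall>K\<in>\<K>. \<not> {y1, y2} \<subseteq> K \<and> \<not> {y1, y3} \<subseteq> K \<and> \<not> {y2, y3} \<subseteq> K"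
    proof
      fix K assume "K \<in> \<K>"
      then have "y1 \<in> K \<Longrightarrow> K = K1" "y2 \<in> K \<Longrightarrow> K = K2" "y3 \<in> K \<Longrightarrow> K = K3"
        using uniq K y by blast+
      then show "\<not> {y1, y2} \<subseteq> K \<and> \<not> {y1, y3} \<subseteq> K \<and> \<not> {y2, y3} \<subseteq> K"
        using K' by (metis insert_subset)
    qed
    moreover have "{y1, y2, y3} \<subseteq> ?V - X" using K y inV by simp
    ultimately show ?thesis using y by blast
  qed

  \<comment> \<open>An \<open>EB\<close> node has just three neighbours, and two of them, the copies
    of \<open>b\<close>, are adjacent. It therefore touches at most two parts.\<close>
  have EB: "EB p b \<notin> X" for p b
  proof
    assume "EB p b \<in> X"
    from three[OF this] obtain y1 y2 y3 where y: "{y1, y2, y3} \<subseteq> ?V - X"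
      and adj: "gadget_adj (EB p b) y1" "gadget_adj (EB p b) y2" "gadget_adj (EB p b) y3"
      and apart: "\<forall>K\<in>\<K>. \<not> {y1, y2} \<subseteq> K \<and> \<not> {y1, y3} \<subseteq> K \<and> \<not> {y2, y3} \<subseteq> K"
      by (elim exE conjE) (rule that; assumption)
    have distinct: "y1 \<noteq> y2" "y1 \<noteq> y3" "y2 \<noteq> y3"
      using apart cls[of y1] cls[of y2] y by auto
    have bv: "{BV b False, BV b True} \<subseteq> {y1, y2, y3}"
      using adj distinct by (auto simp: gadget_adj_iff)
    then have in_V: "BV b False \<in> ?V - X" "BV b True \<in> ?V - X"
      using subset_trans[OF bv y] by simp_all
    then obtain K where K: "K \<in> \<K>" "BV b False \<in> K" using cls[of "BV b False"] by auto
    have "BV b True \<in> K"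
      using same[OF K, of "BV b True"] in_V by simp
    then show False using apart[rule_format, OF K(1)] K bv by auto
  qed
  \<comment> \<open>Both copies of \<open>p\<close> must lie outside \<open>X\<close> in different
    parts; a node \<open>EP p c\<close> outside \<open>X\<close> would join them.\<close>
  have EP: "PV p i \<notin> X \<and> EP p c \<in> X" if pb: "EP p b \<in> X" and pc: "(p, c) \<in> R" for p b c i
  proof -
    from three[OF pb] obtain y1 y2 y3 where y: "{y1, y2, y3} \<subseteq> ?V - X"
      and adj: "gadget_adj (EP p b) y1" "gadget_adj (EP p b) y2" "gadget_adj (EP p b) y3"
      and apart: "\<forall>K\<in>\<K>. \<not> {y1, y2} \<subseteq> K \<and> \<not> {y1, y3} \<subseteq> K \<and> \<not> {y2, y3} \<subseteq> K"
      by (elim exE conjE) (rule that; assumption)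
    have distinct: "y1 \<noteq> y2" "y1 \<noteq> y3" "y2 \<noteq> y3"
      using apart cls[of y1] cls[of y2] y by auto
    have PV: "{PV p False, PV p True} \<subseteq> {y1, y2, y3}"
      using adj distinct by (auto simp: gadget_adj_iff)
    have "EP p c \<in> X"
    proof (rule ccontr)
      assume "EP p c \<notin> X"
      then obtain K where K: "K \<in> \<K>" "EP p c \<in> K" using cls[of "EP p c"] pc by auto
      have "PV p False \<in> K" "PV p True \<in> K"
        using subset_trans[OF PV y] same[OF K, of "PV p False"] same[OF K, of "PV p True"] by auto
      then show False using apart[rule_format, OF K(1)] PV by auto
    qed
    moreover have "PV p i \<notin> X" using subset_trans[OF PV y] by (cases i) auto
    ultimately show ?thesis by blast
  qed
  \<comment> \<open>The two copies of \<open>p\<close> have the same neighbours. If one copy stays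
    outside \<open>X\<close>, all neighbours of the other that avoid \<open>X\<close> lie in one
    part.\<close>
  have PV: "PV p (\<not> i) \<in> X" if pi: "PV p i \<in> X" for p i
  proof (rule ccontr)
    assume no: "PV p (\<not> i) \<notin> X"
    from three[OF pi] obtain y1 y2 y3 where y: "{y1, y2, y3} \<subseteq> ?V - X"
      and adj: "gadget_adj (PV p i) y1" "gadget_adj (PV p i) y2" "gadget_adj (PV p i) y3"
      and apart: "\<forall>K\<in>\<K>. \<not> {y1, y2} \<subseteq> K \<and> \<not> {y1, y3} \<subseteq> K \<and> \<not> {y2, y3} \<subseteq> K"
      by (elim exE conjE) (rule that; assumption)
    from adj obtain b c where bc: "y1 = EP p b" "y2 = EP p c" by (auto simp: gadget_adj_iff)
    have "PV p (\<not> i) \<in> ?V" using pi XV by fastforce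
    then obtain K where K: "K \<in> \<K>" "PV p (\<not> i) \<in> K" using cls no by blast
    have "y1 \<in> K" "y2 \<in> K" using y bc same[OF K] by auto
    then show False using apart K(1) by simp
  qed
  \<comment> \<open>The argument for \<open>PV\<close> applies again, except that the other copy is
    itself a neighbour, in the same part as the rest.\<close>
  have BV: "BV b (\<not> i) \<in> X" if bi: "BV b i \<in> X" for b i
  proof (rule ccontr)
    assume no: "BV b (\<not> i) \<notin> X"
    have bV: "BV b (\<not> i) \<in> ?V" using bi XV by fastforce
    then obtain K where K: "K \<in> \<K>" "BV b (\<not> i) \<in> K" using cls no by blast
    have near: "y \<in> K" if "y \<in> ?V - X" "gadget_adj (BV b i) y" for y
      using that K same[OF K] by (auto simp: gadget_adj_iff)
    from three[OF bi] obtain y1 y2 y3 where "{y1, y2, y3} \<subseteq> ?V - X"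
      and "gadget_adj (BV b i) y1" "gadget_adj (BV b i) y2" "gadget_adj (BV b i) y3"
      and "\<forall>K\<in>\<K>. \<not> {y1, y2} \<subseteq> K \<and> \<not> {y1, y3} \<subseteq> K \<and> \<not> {y2, y3} \<subseteq> K"
      by (elim exE conjE) (rule that; assumption)
    then show False using near[of y1] near[of y2] K(1) by simp
  qed

  define T where "T = {p \<in> P. \<exists>b. EP p b \<in> X}"
  define U where "U = {b \<in> B. BV b False \<in> X}"
  define W where "W = {p \<in> P. PV p False \<in> X}"
  define RT where "RT = {(p, b) \<in> R. p \<in> T}"
  have TP: "T \<subseteq> P" and UB: "U \<subseteq> B" and WP: "W \<subseteq> P" by (auto simp: T_def U_def W_def)
  have "RT \<subseteq> R" by (auto simp: RT_def)
  then have finT: "finite T" "finite U" "finite W" "finite RT"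
    using TP UB WP fin finR by (meson finite_subset)+
  have EPT: "EP p b \<in> X \<longleftrightarrow> (p, b) \<in> RT" for p b
  proof
    assume "EP p b \<in> X"
    moreover have "(p, b) \<in> R" using calculation XV by fastforce
    ultimately show "(p, b) \<in> RT" using R by (auto simp: RT_def T_def)
  next
    assume "(p, b) \<in> RT"
    then show "EP p b \<in> X" using EP by (auto simp: RT_def T_def)
  qed
  have PVT: "PV p i \<notin> X" if "p \<in> T" for p i
    using that deg EP unfolding T_def by blast
  \<comment> \<open>\<open>Sp\<close> has size \<open>2 * card T + card RT\<close>, and
    \<open>X\<close> contains the \<open>card RT\<close> nodes \<open>EP p b\<close> with
    \<open>p\<close> in \<open>T\<close>. The term \<open>card RT\<close> thus cancels when the two
    sizes are compared.\<close>
  define Sp where "Sp = (\<lambda>(p, i). PV p i) ` (T \<times> UNIV) \<union> (\<lambda>(p, b). EB p b) ` RT"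
  have Sp_simps: "PV p i \<in> Sp \<longleftrightarrow> p \<in> T" "EB p b \<in> Sp \<longleftrightarrow> (p, b) \<in> RT"
    "EP p b \<notin> Sp" "BV b i \<notin> Sp" for p b i by (auto simp: Sp_def)
  have SpV: "Sp \<subseteq> ?V - X" using TP PVT EB by (auto simp: Sp_def RT_def)
  have cardSp: "card Sp = 2 * card T + card RT"
  proof -
    have "card Sp = card ((\<lambda>(p, i). PV p i :: ('p, 'b) gadget) ` (T \<times> (UNIV :: bool set)))
        + card ((\<lambda>(p, b). EB p b) ` RT)"
      unfolding Sp_def using finT by (intro card_Un_disjoint) auto
    also have "\<dots> = card (T \<times> (UNIV :: bool set)) + card RT"
      by (subst (1 2) card_image) (auto simp: inj_on_def)
    finally show ?thesis by (simp add: card_cartesian_product)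
  qed
  have cardX: "2 * card U + 2 * card W + card RT \<le> card X"
  proof -
    let ?I = "(\<lambda>(p, i). PV p i :: ('p, 'b) gadget) ` (W \<times> (UNIV :: bool set))"
    let ?J = "(\<lambda>(b, i). BV b i :: ('p, 'b) gadget) ` (U \<times> (UNIV :: bool set))"
    let ?L = "(\<lambda>(p, b). EP p b) ` RT"
    have "PV p i \<in> X" if "p \<in> W" for p i using PV[of p False] that by (cases i) (auto simp: W_def)
    moreover have "BV b i \<in> X" if "b \<in> U" for b i using BV[of b False] that by (cases i) (auto simp: U_def)
    ultimately have "?I \<union> ?J \<union> ?L \<subseteq> X" using EPT by auto
    then have "card (?I \<union> ?J \<union> ?L) \<le> card X" using finX by (rule card_mono[rotated])
    moreover have "card (?I \<union> ?J \<union> ?L) = card ?I + card ?J + card ?L"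
      using finT by (subst card_Un_disjoint; auto)+
    moreover have "card ?I = card (W \<times> (UNIV :: bool set))" "card ?J = card (U \<times> (UNIV :: bool set))"
      "card ?L = card RT"
      by (rule card_image, auto simp: inj_on_def)+
    ultimately show ?thesis by (simp add: card_cartesian_product)
  qed
  have parity: "even (card K) \<longleftrightarrow> even (card (K \<inter> Sp))" if K: "K \<in> \<K>" for K
  proof -
    define \<sigma> :: "('p, 'b) gadget \<Rightarrow> ('p, 'b) gadget"
      where "\<sigma> v = (case v of PV p i \<Rightarrow> PV p (\<not> i) | EP p b \<Rightarrow> EB p b | EB p b \<Rightarrow> EP p b
        | BV b i \<Rightarrow> BV b (\<not> i))" for v
    have "\<sigma> v \<in> K - Sp \<and> \<sigma> (\<sigma> v) = v \<and> \<sigma> v \<noteq> v" if v: "v \<in> K - Sp" for v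
    proof -
      have vK: "v \<in> K" and vV: "v \<in> ?V" "v \<notin> X" using v inV[OF K] by auto
      show ?thesis
      proof (cases v)
        case (PV p i)
        then have p: "p \<in> P" "p \<notin> T" using vV v by (auto simp: Sp_simps)
        obtain b where b: "(p, b) \<in> R" using deg p by blast
        have "EP p b \<in> K"
          using same[OF K vK, of "EP p b"] b EPT p PV by (auto simp: RT_def)
        moreover have "PV p (\<not> i) \<notin> X" using \<open>v \<notin> X\<close> PV \<open>\<And>p i. PV p i \<in> X \<Longrightarrow> PV p (\<not> i) \<in> X\<close>[of p "\<not> i"] by auto
        ultimately have "PV p (\<not> i) \<in> K"
          using same[OF K, of "EP p b" "PV p (\<not> i)"] p by simp
        then show ?thesis using PV p by (simp add: \<sigma>_def Sp_simps)
      next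
        case (EP p b)
        then have "(p, b) \<in> R" "(p, b) \<notin> RT" using vV EPT by auto
        then show ?thesis
          using EP same[OF K vK, of "EB p b"] EB by (simp add: \<sigma>_def Sp_simps)
      next
        case (EB p b)
        then have "(p, b) \<in> R" "(p, b) \<notin> RT" using vV v by (auto simp: Sp_simps)
        then show ?thesis
          using EB same[OF K vK, of "EP p b"] EPT by (simp add: \<sigma>_def Sp_simps)
      next
        case (BV b i)
        then have "b \<in> B" "BV b (\<not> i) \<notin> X"
          using vV \<open>\<And>b i. BV b i \<in> X \<Longrightarrow> BV b (\<not> i) \<in> X\<close>[of b "\<not> i"] by auto
        then show ?thesis
          using BV same[OF K vK, of "BV b (\<not> i)"] by (simp add: \<sigma>_def Sp_simps)
      qed
    qed
    then have "even (card (K - Sp))"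
      using finE[OF K] by (intro even_card_involution[of _ \<sigma>]) auto
    moreover have "card K = card (K \<inter> Sp) + card (K - Sp)"
      using finE[OF K] by (subst card_Un_disjoint[symmetric]) (auto intro: arg_cong[where f = card])
    ultimately show ?thesis by simp
  qed
  \<comment> \<open>A part with \<open>2 * n K\<close> elements of \<open>Sp\<close> has yet another
    one if it is odd, by \<open>parity\<close>. Summing over the parts, comparing with
    \<open>cardX\<close> and halving gives the bound; the choice of \<open>n\<close> measures how
    much \<open>Sp\<close> clusters inside parts.\<close>
  have count: "card U + card W + (\<Sum>K\<in>\<K>. n K) < card T"
    if n: "\<And>K. K \<in> \<K> \<Longrightarrow> 2 * n K \<le> card (K \<inter> Sp)" for n
  proof -
    have "card Sp = card (\<Union>K\<in>\<K>. K \<inter> Sp)" using SpV un by (intro arg_cong[where f = card]) auto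
    also have "\<dots> = (\<Sum>K\<in>\<K>. card (K \<inter> Sp))"
      using finK finE dj by (intro card_UN_disjoint) (auto simp: disjoint_def)
    finally have w: "card Sp = (\<Sum>K\<in>\<K>. card (K \<inter> Sp))" .
    have "(if odd (card K) then 1 else 0) + 2 * n K \<le> card (K \<inter> Sp)" if "K \<in> \<K>" for K
      using n[OF that] parity[OF that] by (cases "2 * n K = card (K \<inter> Sp)") (auto, presburger+)
    then have "(\<Sum>K\<in>\<K>. (if odd (card K) then 1 else 0) + 2 * n K) \<le> card Sp"
      unfolding w by (rule sum_mono)
    moreover have "(\<Sum>K\<in>\<K>. (if odd (card K) then 1 else 0)) = card {K \<in> \<K>. odd (card K)}"
      using finK by (simp add: sum.If_cases Int_def)
    ultimately have "card {K \<in> \<K>. odd (card K)} + 2 * (\<Sum>K\<in>\<K>. n K) \<le> card Sp"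
      by (simp add: sum.distrib sum_distrib_left)
    then show ?thesis using cardSp cardX odd by linarith
  qed

  define M where "M = {b \<in> B - U. 2 \<le> card {p \<in> T. (p, b) \<in> R}}"
  \<comment> \<open>Each \<open>b\<close> in \<open>M\<close> is charged to the part containing
    \<open>BV b False\<close>. That part also contains the nodes \<open>EB p b\<close> of all
    neighbours \<open>p\<close> in \<open>T\<close>, hence at least two elements of
    \<open>Sp\<close> for each such \<open>b\<close>.\<close>
  define MK where "MK K = {b \<in> M. BV b False \<in> K}" for K :: "('p, 'b) gadget set"
  have finM: "finite M" using fin by (simp add: M_def)
  have "2 * card (MK K) \<le> card (K \<inter> Sp)" if K: "K \<in> \<K>" for K
  proof -
    let ?S = "SIGMA b:MK K. {p \<in> T. (p, b) \<in> R}"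
    have "2 * card (MK K) = (\<Sum>b\<in>MK K. 2)" by simp
    also have "\<dots> \<le> (\<Sum>b\<in>MK K. card {p \<in> T. (p, b) \<in> R})"
      by (rule sum_mono) (auto simp: MK_def M_def)
    also have "\<dots> = card ?S" using finM finT by (subst card_SigmaI) (auto simp: MK_def)
    also have "\<dots> = card ((\<lambda>(b, p). EB p b) ` ?S)"
      by (rule card_image[symmetric]) (auto simp: inj_on_def)
    also have "\<dots> \<le> card (K \<inter> Sp)"
    proof (rule card_mono)
      show "(\<lambda>(b, p). EB p b) ` ?S \<subseteq> K \<inter> Sp"
        using same[OF K] EB by (auto simp: MK_def Sp_simps RT_def)
    qed (use finE K in simp)
    finally show ?thesis .
  qed
  then have "card U + card W + (\<Sum>K\<in>\<K>. card (MK K)) < card T" by (rule count)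
  moreover have "(\<Sum>K\<in>\<K>. card (MK K)) = card M"
  proof -
    have "(\<Sum>K\<in>\<K>. card (MK K)) = card (\<Union>K\<in>\<K>. MK K)"
      using finK finM dj by (intro card_UN_disjoint[symmetric]) (auto simp: MK_def disjoint_def)
    also have "(\<Union>K\<in>\<K>. MK K) = M"
    proof (intro equalityI subsetI)
      fix b assume "b \<in> M"
      moreover then have "BV b False \<in> ?V" "BV b False \<notin> X" by (auto simp: M_def U_def)
      ultimately show "b \<in> (\<Union>K\<in>\<K>. MK K)" using cls[of "BV b False"] by (auto simp: MK_def)
    qed (auto simp: MK_def)
    finally show ?thesis .
  qed
  ultimately have bound: "card U + card W + card M < card T" by simp

  \<comment> \<open>The gadget nodes of \<open>p\<close> avoid \<open>X\<close>, so the two paths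
    from \<open>p\<close> to \<open>t\<close> through \<open>b\<close> and \<open>c\<close> put
    \<open>EB t b\<close> and \<open>EB t c\<close> into one part. Taking \<open>n\<close> as the
    indicator of this part in \<open>count\<close> yields \<open>1 < 1\<close>.\<close>
  have single: False
    if "T = {t}" "U = {}" "W = {}" "p \<noteq> t" "b \<noteq> c" "{(t, b), (t, c), (p, b), (p, c)} \<subseteq> R" for t p b c
  proof -
    have pP: "p \<in> P" "p \<notin> T" "b \<in> B" "c \<in> B" using that R by auto
    have noX: "EP p x \<notin> X" "PV p False \<notin> X" "BV b False \<notin> X" "BV c False \<notin> X" for x
      using that pP EPT by (auto simp: RT_def U_def W_def)
    obtain K where K: "K \<in> \<K>" "PV p False \<in> K" using cls[of "PV p False"] noX pP by auto
    have "EB t x \<in> K" if x: "x \<in> {b, c}" for x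
    proof -
      have xs: "(p, x) \<in> R" "(t, x) \<in> R" "x \<in> B" "BV x False \<notin> X"
        using x that(1) pP noX \<open>{(t, b), (t, c), (p, b), (p, c)} \<subseteq> R\<close> by auto
      have "EP p x \<in> K" using same[OF K(1) K(2), of "EP p x"] xs noX by simp
      then have "EB p x \<in> K" using same[OF K(1), of "EP p x" "EB p x"] xs EB by simp
      then have "BV x False \<in> K" using same[OF K(1), of "EB p x" "BV x False"] xs by simp
      then show ?thesis using same[OF K(1), of "BV x False" "EB t x"] xs EB by simp
    qed
    then have "{EB t b, EB t c} \<subseteq> K \<inter> Sp" using that by (auto simp: Sp_simps RT_def)
    then have "2 \<le> card (K \<inter> Sp)"
      using card_mono[of "K \<inter> Sp" "{EB t b, EB t c}"] finE[OF K(1)] \<open>b \<noteq> c\<close> by simp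
    then have "card U + card W + (\<Sum>L\<in>\<K>. if L = K then 1 else 0) < card T"
      by (intro count) auto
    then show False using that K finK by simp
  qed
  show ?thesis
    using TP UB WP bound[unfolded M_def] single by (intro exI conjI allI impI notI)
qed

section \<open>The finite 2-factor theorem\<close>

theorem double_Hall_two_factor:
  fixes P :: "'p set" and B :: "'b set"
  assumes fin: "finite P" "finite B" and R: "R \<subseteq> P \<times> B" and P: "2 \<le> card P"
    and hall: "\<And>Q. Q \<subseteq> P \<Longrightarrow> 2 \<le> card Q \<Longrightarrow> card Q \<le> card {b \<in> B. 2 \<le> card {p \<in> Q. (p, b) \<in> R}}"
  shows "\<exists>H\<subseteq>R. (\<forall>p\<in>P. card (H `` {p}) = 2) \<and> (\<forall>b. H\<inverse> `` {b} = {} \<or> card (H\<inverse> `` {b}) = 2)"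
proof -
  let ?V = "gadget_vertices P B R"
  have common: "\<exists>b c. b \<noteq> c \<and> {(p, b), (p, c), (q, b), (q, c)} \<subseteq> R"
    if "p \<in> P" "q \<in> P" "p \<noteq> q" for p q
  proof -
    let ?N = "{b \<in> B. 2 \<le> card {x \<in> {p, q}. (x, b) \<in> R}}"
    have "2 \<le> card ?N" using hall[of "{p, q}"] that by simp
    then obtain S where "S \<subseteq> ?N" "card S = 2" by (meson obtain_subset_with_card_n)
    then obtain b c where bc: "b \<in> ?N" "c \<in> ?N" "b \<noteq> c" by (auto simp: card_2_iff)
    have "(p, x) \<in> R \<and> (q, x) \<in> R" if "x \<in> ?N" for x
    proof -
      have "{y \<in> {p, q}. (y, x) \<in> R} = {p, q}"
        using that \<open>p \<noteq> q\<close> by (intro card_seteq) auto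
      then show ?thesis by blast
    qed
    then show ?thesis using bc by blast
  qed
  obtain S where "S \<subseteq> P" "card S = 2" using P by (meson obtain_subset_with_card_n)
  then have other: "\<exists>q\<in>P. q \<noteq> p" for p by (metis card_2_iff insert_subset)
  have deg: "\<forall>p\<in>P. \<exists>b. (p, b) \<in> R" using other common by blast
  have "\<not> barrier ?V gadget_adj X \<K>" for X \<K>
  proof
    assume "barrier ?V gadget_adj X \<K>"
    then have "\<exists>X. \<exists>\<K>. barrier ?V gadget_adj X \<K>" by blast
    from ex_has_least_nat[of "\<lambda>X. \<exists>\<K>. barrier ?V gadget_adj X \<K>" _ card] this
    obtain X \<K> where bar: "barrier ?V gadget_adj X \<K>"
      and min: "\<forall>X' \<K>'. barrier ?V gadget_adj X' \<K>' \<longrightarrow> card X \<le> card X'" by blast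
    obtain T U W where TUW: "T \<subseteq> P" "U \<subseteq> B" "W \<subseteq> P"
      and bound: "card U + card W + card {b \<in> B - U. 2 \<le> card {p \<in> T. (p, b) \<in> R}} < card T"
      and single: "\<And>t p b c. T = {t} \<Longrightarrow> U = {} \<Longrightarrow> W = {} \<Longrightarrow> p \<noteq> t \<Longrightarrow> b \<noteq> c \<Longrightarrow>
        \<not> {(t, b), (t, c), (p, b), (p, c)} \<subseteq> R"
      using gadget_barrier_bound[OF fin R deg bar min] by (elim exE conjE) simp
    have finU: "finite U" "finite W" using TUW fin by (meson finite_subset)+
    show False
    proof (cases "2 \<le> card T")
      case True
      \<comment> \<open>\<open>N^2(T)\<close> is covered by \<open>U\<close> and the set counted in
        \<open>bound\<close>, so it has fewer than \<open>card T\<close> elements.\<close>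
      have "card {b \<in> B. 2 \<le> card {p \<in> T. (p, b) \<in> R}}
          \<le> card (U \<union> {b \<in> B - U. 2 \<le> card {p \<in> T. (p, b) \<in> R}})"
        using fin finU by (intro card_mono) auto
      also have "\<dots> \<le> card U + card {b \<in> B - U. 2 \<le> card {p \<in> T. (p, b) \<in> R}}"
        by (rule card_Un_le)
      finally show False using hall[OF TUW(1) True] bound by linarith
    next
      case False
      \<comment> \<open>The strict inequality in \<open>bound\<close> excludes an empty
        \<open>T\<close> and forces \<open>U\<close> and \<open>W\<close> to be empty.\<close>
      then have "card T = 1" "card U = 0" "card W = 0" using bound by linarith+
      then obtain t where t: "T = {t}" "U = {}" "W = {}"
        using finU by (metis card_1_singletonE card_0_eq)
      then have "t \<in> P" using TUW by simp
      obtain p where "p \<in> P" "p \<noteq> t" using other by blast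
      with common[of t p] \<open>t \<in> P\<close> obtain b c where "b \<noteq> c" "{(t, b), (t, c), (p, b), (p, c)} \<subseteq> R" by auto
      then show False using single[OF t \<open>p \<noteq> t\<close>] by blast
    qed
  qed
  then obtain f where "perfect_matching ?V gadget_adj f"
    using perfect_matching_or_barrier[OF finite_gadget_vertices[OF fin R] symp_gadget_adj irreflp_gadget_adj] by blast
  then show ?thesis by (rule two_factor_of_gadget_matching[OF R])
qed

section \<open>Extension to countable graphs\<close>

lemma not_pseudo_isolated_path:
  assumes G: "simple_graph G" and v: "v \<in> vertices G" "\<not> pseudo_isolated G v"
    and F: "finite F"
  obtains b w where "{v, b} \<in> edges G" "{w, b} \<in> edges G" "w \<noteq> v" "b \<notin> F" "w \<notin> F"
proof -
  \<comment> \<open>\<open>F\<close> may contain \<open>v\<close> or non-vertices, which the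
    definition of pseudo-isolation does not allow to be deleted. Since \<open>b\<close> and
    \<open>w\<close> turn out to differ from \<open>v\<close>, they avoid all of
    \<open>F\<close>.\<close>
  define D where "D = delete_vertices G (vertices G \<inter> (F - {v}))"
  have "finite (vertices G \<inter> (F - {v}))" "vertices G \<inter> (F - {v}) \<subseteq> vertices G - {v}"
    using F by auto
  then obtain w where w: "w \<in> vertices D" "gdist D v w = 2"
    using v unfolding pseudo_isolated_def D_def by blast
  have vD: "v \<in> vertices D" using v by (simp add: D_def delete_vertices_def)
  let ?W = "{p. walk D p \<and> hd p = v \<and> last p = w}"
  let ?L = "(\<lambda>p. enat (length p - 1)) ` ?W"
  have "?L \<noteq> {}"
  proof
    assume "?L = {}"
    then have "gdist D v w = \<infinity>" by (simp only: gdist_def) (simp add: top_enat_def)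
    then show False using w by simp
  qed
  \<comment> \<open>A nonempty infimum in \<open>enat\<close> is attained, so the distance 2 comes
    from an actual walk with three vertices.\<close>
  then have "Inf ?L \<in> ?L" unfolding Inf_enat_def by (auto intro: LeastI)
  then have "2 \<in> ?L" using w(2) by (simp add: gdist_def)
  then obtain p where p: "walk D p" "hd p = v" "last p = w" "enat (length p - 1) = 2" by force
  have "w \<noteq> v"
  proof
    assume "w = v"
    then have "walk D [v] \<and> hd [v] = v \<and> last [v] = w" using vD by (simp add: walk_def)
    then have "gdist D v w \<le> enat (length [v] - 1)"
      unfolding gdist_def by (intro INF_lower) (simp only: mem_Collect_eq)
    then show False using w(2) by (simp add: zero_enat_def[symmetric])
  qed
  have "length p = 3" using p(4) by (simp add: numeral_eq_enat)
  then obtain x b y where "p = [x, b, y]" by (auto simp: length_Suc_conv numeral_3_eq_3)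
  then have e: "{v, b} \<in> edges D" "{b, w} \<in> edges D" "b \<in> vertices D"
    using p by (auto simp: walk_def)
  have "{v, b} \<in> edges G" "{w, b} \<in> edges G"
    using e by (auto simp: D_def delete_vertices_def insert_commute)
  moreover have "b \<noteq> v"
    using calculation G unfolding simple_graph_def by fastforce
  then have "b \<notin> F" "w \<notin> F"
    using e w \<open>w \<noteq> v\<close> by (auto simp: D_def delete_vertices_def)
  ultimately show thesis using that \<open>w \<noteq> v\<close> by blast
qed

text \<open>Since a used vertex on the right has its full degree 2, extending a partial 2-factor never
  changes it there.\<close>

definition partial_two_factor :: "('p \<times> 'b) set \<Rightarrow> ('p \<times> 'b) set \<Rightarrow> bool" where
  "partial_two_factor R H \<longleftrightarrow> H \<subseteq> R \<and> finite H \<and> (\<forall>p. card (H `` {p}) \<le> 2) \<and>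
     (\<forall>b. H\<inverse> `` {b} = {} \<or> card (H\<inverse> `` {b}) = 2)"

section \<open>Growing partial 2-factors\<close>

lemma partial_two_factor_add:
  assumes H: "partial_two_factor R H" and a: "card (H `` {a}) < 2"
    and b: "(a, b) \<in> R" "(w, b) \<in> R" "w \<noteq> a" "b \<notin> Range H" "w \<notin> Domain H"
  shows "partial_two_factor R (H \<union> {(a, b), (w, b)})" and "card ((H \<union> {(a, b), (w, b)}) `` {a}) = Suc (card (H `` {a}))"
proof -
  let ?H = "H \<union> {(a, b), (w, b)}"
  have fin: "finite H" using H by (simp add: partial_two_factor_def)
  have ims: "?H `` {a} = insert b (H `` {a})" "?H `` {w} = {b}"
    "\<And>p. p \<noteq> a \<Longrightarrow> p \<noteq> w \<Longrightarrow> ?H `` {p} = H `` {p}"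
    "?H\<inverse> `` {b} = {a, w}" "\<And>c. c \<noteq> b \<Longrightarrow> ?H\<inverse> `` {c} = H\<inverse> `` {c}"
    using b by auto
  show c: "card (?H `` {a}) = Suc (card (H `` {a}))"
    unfolding ims(1) using b fin by (subst card_insert_disjoint) (auto intro: finite_Image)
  have "card (?H `` {p}) \<le> 2" for p
  proof -
    consider "p = a" | "p = w" | "p \<noteq> a" "p \<noteq> w" by blast
    then show ?thesis
    proof cases
      case 1
      then show ?thesis using c a by simp
    next
      case 2
      then show ?thesis using ims(2) by simp
    next
      case 3
      then show ?thesis using ims(3) H by (simp add: partial_two_factor_def)
    qed
  qed
  moreover have "?H\<inverse> `` {c} = {} \<or> card (?H\<inverse> `` {c}) = 2" for c
  proof (cases "c = b")
    case True
    then show ?thesis using ims(4) b by simp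
  next
    case False
    then show ?thesis using ims(5)[OF False] H by (simp only: partial_two_factor_def)
  qed
  ultimately show "partial_two_factor R ?H"
    using H b unfolding partial_two_factor_def by blast
qed


text \<open>As \<open>H\<close> is finite, \<open>ext\<close> always supplies a path avoiding it,
  and at most two additions are needed.\<close>

lemma partial_two_factor_saturate:
  fixes R H :: "('p \<times> 'b) set"
  assumes "partial_two_factor R H"
    and ext: "\<And>F F'. finite F \<Longrightarrow> finite F' \<Longrightarrow>
      \<exists>b w. (a, b) \<in> R \<and> (w, b) \<in> R \<and> w \<noteq> a \<and> b \<notin> F \<and> w \<notin> F'"
  shows "\<exists>H'. H \<subseteq> H' \<and> partial_two_factor R H' \<and> card (H' `` {a}) = 2"
  using assms(1)
proof (induction "2 - card (H `` {a})" arbitrary: H rule: less_induct)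
  case less
  show ?case
  proof (cases "card (H `` {a}) < 2")
    case False
    then have "card (H `` {a}) = 2"
      using less.prems by (meson le_antisym not_less partial_two_factor_def)
    then show ?thesis using less.prems by blast
  next
    case True
    have fin: "finite (Range H)" "finite (Domain H)"
      using less.prems by (auto simp: partial_two_factor_def finite_Range finite_Domain)
    obtain b w where b: "(a, b) \<in> R" "(w, b) \<in> R" "w \<noteq> a" "b \<notin> Range H" "w \<notin> Domain H"
      using ext[OF fin] by (elim exE conjE) (rule that)
    let ?H = "H \<union> {(a, b), (w, b)}"
    note add = partial_two_factor_add[OF less.prems True b]
    have "\<exists>H'. ?H \<subseteq> H' \<and> partial_two_factor R H' \<and> card (H' `` {a}) = 2"
      using less.hyps[OF _ add(1)] add(2) True by simp
    then show ?thesis by blast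
  qed
qed

text \<open>Saturate the elements of \<open>A\<close> one by one and take the union of the stages.
  The edges at \<open>a\<close> are frozen once its degree is 2, and those at \<open>b\<close> as
  soon as \<open>b\<close> is used, so both degree conditions pass to the union.\<close>

lemma countable_two_factor:
  assumes A: "countable A" "A \<noteq> {}" and H0: "partial_two_factor R H0"
    and step: "\<And>H a. partial_two_factor R H \<Longrightarrow> H0 \<subseteq> H \<Longrightarrow> a \<in> A \<Longrightarrow>
      \<exists>H'. H \<subseteq> H' \<and> partial_two_factor R H' \<and> card (H' `` {a}) = 2"
  shows "\<exists>H\<subseteq>R. (\<forall>a\<in>A. card (H `` {a}) = 2) \<and> (\<forall>b. H\<inverse> `` {b} = {} \<or> card (H\<inverse> `` {b}) = 2)"
proof -
  define e where "e = from_nat_into A"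
  have eA: "e n \<in> A" for n using A by (simp add: e_def from_nat_into)
  have e: "\<exists>n. e n = a" if "a \<in> A" for a
    using that A by (metis e_def from_nat_into_surj)
  have "\<exists>S. \<forall>n. (partial_two_factor R (S n) \<and> H0 \<subseteq> S n) \<and>
      (S n \<subseteq> S (Suc n) \<and> card (S (Suc n) `` {e n}) = 2)"
  proof (rule dependent_nat_choice)
    show "\<exists>H. partial_two_factor R H \<and> H0 \<subseteq> H" using H0 by blast
    show "\<exists>H'. (partial_two_factor R H' \<and> H0 \<subseteq> H') \<and> H \<subseteq> H' \<and> card (H' `` {e n}) = 2"
      if "partial_two_factor R H \<and> H0 \<subseteq> H" for H n
      using step[of H "e n"] that eA by blast
  qed
  then obtain S where S: "\<And>n. partial_two_factor R (S n)" "\<And>n. S n \<subseteq> S (Suc n)"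
    "\<And>n. card (S (Suc n) `` {e n}) = 2" by blast
  have mono: "S m \<subseteq> S n" if "m \<le> n" for m n using S(2) that by (rule lift_Suc_mono_le)
  define H where "H = (\<Union>n. S n)"
  have "H \<subseteq> R" using S(1) by (auto simp: H_def partial_two_factor_def)
  moreover have "card (H `` {a}) = 2" if "a \<in> A" for a
  proof -
    obtain n where n: "e n = a" using e \<open>a \<in> A\<close> by blast
    have "S m `` {a} \<subseteq> S (Suc n) `` {a}" for m
    proof -
      let ?k = "max m (Suc n)"
      \<comment> \<open>The larger set has at most two elements and the smaller one already has
        two.\<close>
      have "S (Suc n) `` {a} = S ?k `` {a}"
      proof (rule card_seteq)
        show "finite (S ?k `` {a})" using S(1) by (simp add: partial_two_factor_def finite_Image)
        show "S (Suc n) `` {a} \<subseteq> S ?k `` {a}" using mono[of "Suc n" ?k] by auto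
        show "card (S ?k `` {a}) \<le> card (S (Suc n) `` {a})"
          using S(1) S(3)[of n] n by (simp add: partial_two_factor_def)
      qed
      then show ?thesis using mono[of m ?k] by auto
    qed
    then have "H `` {a} = S (Suc n) `` {a}" by (auto simp: H_def)
    then show ?thesis using S(3)[of n] n by simp
  qed
  moreover have "H\<inverse> `` {b} = {} \<or> card (H\<inverse> `` {b}) = 2" for b
  proof (cases "H\<inverse> `` {b} = {}")
    case False
    then obtain p n where p: "(p, b) \<in> S n" by (auto simp: H_def)
    have two: "card ((S k)\<inverse> `` {b}) = 2" if "n \<le> k" for k
    proof -
      have "p \<in> (S k)\<inverse> `` {b}" using mono[OF that] p by auto
      then show ?thesis using S(1)[of k] unfolding partial_two_factor_def by blast
    qed
    have "(S m)\<inverse> `` {b} \<subseteq> (S n)\<inverse> `` {b}" for m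
    proof -
      let ?k = "max m n"
      have "(S n)\<inverse> `` {b} = (S ?k)\<inverse> `` {b}"
      proof (rule card_seteq)
        show "finite ((S ?k)\<inverse> `` {b})" using S(1) by (simp add: partial_two_factor_def finite_Image)
        show "(S n)\<inverse> `` {b} \<subseteq> (S ?k)\<inverse> `` {b}" using mono[of n ?k] by auto
        show "card ((S ?k)\<inverse> `` {b}) \<le> card ((S n)\<inverse> `` {b})" using two by simp
      qed
      then show ?thesis using mono[of m ?k] by auto
    qed
    then have "H\<inverse> `` {b} = (S n)\<inverse> `` {b}" by (auto simp: H_def)
    then show ?thesis using two by simp
  qed simp
  ultimately show ?thesis by blast
qed

section \<open>From sets of pairs to subgraphs\<close>

text \<open>Only those vertices of \<open>B\<close> that occur in \<open>H\<close> are kept, since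
  the others would have degree 0.\<close>

lemma two_regular_subgraph_of_pairs:
  assumes G: "bipartite G A B" and H: "H \<subseteq> {(a, b). a \<in> A \<and> b \<in> B \<and> {a, b} \<in> edges G}"
    and HA: "\<forall>a\<in>A. card (H `` {a}) = 2"
    and HB: "\<forall>b. H\<inverse> `` {b} = {} \<or> card (H\<inverse> `` {b}) = 2"
  defines "K \<equiv> \<lparr>vertices = A \<union> Range H, edges = (\<lambda>(a, b). {a, b}) ` H\<rparr>"
  shows "subgraph K G \<and> two_regular K"
proof
  have AB: "A \<inter> B = {}" "vertices G = A \<union> B" using G by (auto simp: bipartite_def)
  have HAB: "a \<in> A" "b \<in> B" "{a, b} \<in> edges G" if "(a, b) \<in> H" for a b using that H by auto
  have "a \<noteq> b" if "(a, b) \<in> H" for a b using HAB[OF that] AB by auto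
  then show "subgraph K G"
    using HAB AB by (fastforce simp: subgraph_def simple_graph_def K_def)
  have edge: "{a, b} \<in> edges K \<longleftrightarrow> (a, b) \<in> H" if "a \<in> A \<or> b \<in> B" for a b
    using that HAB AB by (fastforce simp: K_def doubleton_eq_iff)
  show "two_regular K"
    unfolding two_regular_def
  proof
    fix v assume v: "v \<in> vertices K"
    show "card (nbrs K v) = 2"
    proof (cases "v \<in> A")
      case True
      then have "nbrs K v = H `` {v}" using edge by (auto simp: nbrs_def K_def)
      then show ?thesis using HA True by simp
    next
      case False
      then have vB: "v \<in> Range H" "v \<in> B" using v HAB by (auto simp: K_def)
      then have "nbrs K v = H\<inverse> `` {v}"
        using edge[of _ v] HAB by (auto simp: nbrs_def insert_commute K_def)
      moreover have "H\<inverse> `` {v} \<noteq> {}" using vB by auto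
      ultimately show ?thesis using HB by metis
    qed
  qed
qed

theorem theorem3p4:
  fixes G :: "'a ugraph" and A B :: "'a set"
  assumes "bipartite G A B"
    and "infinite A" and "countable A"
    and "infinite B" and "countable B"
    and "dHp_graph G A B"
    and "finite {v \<in> A. pseudo_isolated G v}"
  shows "\<exists>\<C> :: 'a ugraph set.
           (\<forall>H\<in>\<C>. subgraph H G \<and> two_regular H) \<and>
           pairwise (\<lambda>H K. disjnt (vertices H) (vertices K)) \<C> \<and>
           (\<forall>a\<in>A. \<exists>H\<in>\<C>. a \<in> vertices H)"
proof -
  have G: "simple_graph G" "vertices G = A \<union> B" "A \<inter> B = {}"
    and bip: "\<And>e. e \<in> edges G \<Longrightarrow> \<exists>a\<in>A. \<exists>b\<in>B. e = {a, b}"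
    using assms(1) by (auto simp: bipartite_def)
  define R where "R = {(a, b). a \<in> A \<and> b \<in> B \<and> {a, b} \<in> edges G}"
  have inR: "(a, b) \<in> R" if "a \<in> A" "{a, b} \<in> edges G" for a b
    using bip[OF that(2)] that G(3) by (auto simp: R_def doubleton_eq_iff)
  have inR': "(a, b) \<in> R" if "b \<in> B" "{a, b} \<in> edges G" for a b
    using bip[OF that(2)] that G(3) by (auto simp: R_def doubleton_eq_iff)
  \<comment> \<open>Two further vertices guarantee \<open>2 \<le> card P\<close>, even if at most
    one vertex of \<open>A\<close> is pseudo-isolated.\<close>
  obtain A2 where A2: "A2 \<subseteq> A" "finite A2" "card A2 = 2"
    using infinite_arbitrarily_large[OF assms(2)] by blast
  define P where "P = {v \<in> A. pseudo_isolated G v} \<union> A2"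
  have P: "finite P" "P \<subseteq> A" "2 \<le> card P"
    using A2 assms(7) card_mono[of P A2] by (auto simp: P_def)
  \<comment> \<open>\<open>N2 G Q\<close> may be infinite, so a finite piece of size
    \<open>card Q\<close> is cut out as the image of \<open>Q\<close> under the injection given by
    the double Hall property.\<close>
  have "\<exists>D. finite D \<and> card D = card Q \<and> D \<subseteq> {b \<in> B. 2 \<le> card {p \<in> Q. (p, b) \<in> R}}"
    if Q: "Q \<subseteq> P" "2 \<le> card Q" for Q
  proof -
    have "finite Q" using Q P finite_subset by blast
    obtain Q2 where "Q2 \<subseteq> Q" "card Q2 = 2" using Q(2) by (meson obtain_subset_with_card_n)
    then have "at_least_two Q" unfolding at_least_two_def card_2_iff by blast
    then have "Q \<lesssim> N2 G Q" using assms(6) Q P unfolding dHp_graph_def by blast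
    then obtain f where f: "inj_on f Q" "f ` Q \<subseteq> N2 G Q" by (auto simp: lepoll_def)
    have "2 \<le> card {p \<in> Q. (p, b) \<in> R} \<and> b \<in> B" if b: "b \<in> N2 G Q" for b
    proof -
      obtain x y where xy: "x \<in> nbrs G b \<inter> Q" "y \<in> nbrs G b \<inter> Q" "x \<noteq> y"
        using b by (auto simp: N2_def at_least_two_def)
      then have "(x, b) \<in> R" "(y, b) \<in> R"
        using Q P inR[of x b] inR[of y b] by (auto simp: nbrs_def insert_commute)
      then have "{x, y} \<subseteq> {p \<in> Q. (p, b) \<in> R}" "b \<in> B" using xy by (auto simp: R_def)
      then show ?thesis using card_mono[of "{p \<in> Q. (p, b) \<in> R}" "{x, y}"] xy \<open>finite Q\<close> by simp
    qed
    then show ?thesis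
      using f \<open>finite Q\<close> by (intro exI[of _ "f ` Q"]) (auto simp: card_image)
  qed
  then have "\<forall>Q\<in>{Q \<in> Pow P. 2 \<le> card Q}. \<exists>D. finite D \<and> card D = card Q \<and>
      D \<subseteq> {b \<in> B. 2 \<le> card {p \<in> Q. (p, b) \<in> R}}" by blast
  from bchoice[OF this] obtain D where D: "\<And>Q. Q \<subseteq> P \<Longrightarrow> 2 \<le> card Q \<Longrightarrow>
      finite (D Q) \<and> card (D Q) = card Q \<and> D Q \<subseteq> {b \<in> B. 2 \<le> card {p \<in> Q. (p, b) \<in> R}}"
    by blast
  \<comment> \<open>\<open>P\<close> has finitely many subsets, so \<open>B'\<close> is finite, and
    it retains enough of every \<open>N2 G Q\<close> for the finite theorem.\<close>
  define B' where "B' = \<Union>(D ` {Q \<in> Pow P. 2 \<le> card Q})"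
  have finB: "finite B'" unfolding B'_def using P D by auto
  let ?R = "R \<inter> P \<times> B'"
  have "\<exists>H\<subseteq>?R. (\<forall>p\<in>P. card (H `` {p}) = 2) \<and> (\<forall>b. H\<inverse> `` {b} = {} \<or> card (H\<inverse> `` {b}) = 2)"
  proof (rule double_Hall_two_factor)
    fix Q assume Q: "Q \<subseteq> P" "2 \<le> card Q"
    have "D Q \<subseteq> {b \<in> B'. 2 \<le> card {p \<in> Q. (p, b) \<in> ?R}}"
    proof
      fix b assume b: "b \<in> D Q"
      then have "b \<in> B'" using Q by (auto simp: B'_def)
      moreover then have "{p \<in> Q. (p, b) \<in> ?R} = {p \<in> Q. (p, b) \<in> R}" using Q by auto
      ultimately show "b \<in> {b \<in> B'. 2 \<le> card {p \<in> Q. (p, b) \<in> ?R}}" using D[OF Q] b by auto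
    qed
    then show "card Q \<le> card {b \<in> B'. 2 \<le> card {p \<in> Q. (p, b) \<in> ?R}}"
      using D[OF Q] finB card_mono[of "{b \<in> B'. 2 \<le> card {p \<in> Q. (p, b) \<in> ?R}}" "D Q"] by simp
  qed (use P finB in auto)
  then obtain H0 where H0: "H0 \<subseteq> ?R" "\<forall>p\<in>P. card (H0 `` {p}) = 2"
    "\<forall>b. H0\<inverse> `` {b} = {} \<or> card (H0\<inverse> `` {b}) = 2" by blast
  have "card (H0 `` {p}) \<le> 2" for p
  proof (cases "p \<in> P")
    case False
    then have "H0 `` {p} = {}" using H0(1) by auto
    then show ?thesis by simp
  qed (use H0(2) in simp)
  moreover have "finite H0"
    using H0(1) P finB by (meson finite_Int finite_SigmaI finite_subset)
  ultimately have pt0: "partial_two_factor R H0"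
    using H0 by (auto simp: partial_two_factor_def)
  have "\<exists>H'. H \<subseteq> H' \<and> partial_two_factor R H' \<and> card (H' `` {a}) = 2"
    if H: "partial_two_factor R H" "H0 \<subseteq> H" and a: "a \<in> A" for H a
  proof (cases "a \<in> P")
    case True
    \<comment> \<open>Vertices of \<open>P\<close> already have degree 2 in \<open>H0\<close>; this
      is why every stage has to contain \<open>H0\<close>.\<close>
    have "card (H0 `` {a}) \<le> card (H `` {a})"
      using H by (intro card_mono) (auto simp: partial_two_factor_def intro: finite_Image)
    moreover have "card (H `` {a}) \<le> 2" using H by (simp add: partial_two_factor_def)
    ultimately have "card (H `` {a}) = 2" using H0(2) True by auto
    then show ?thesis using H by blast
  next
    case False
    then have np: "a \<in> vertices G" "\<not> pseudo_isolated G a" using a G by (auto simp: P_def)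
    show ?thesis
    proof (rule partial_two_factor_saturate[OF H(1)])
      fix F F' :: "'a set" assume "finite F" "finite F'"
      then have "finite (F \<union> F')" by simp
      from not_pseudo_isolated_path[OF G(1) np this] obtain b w where
        b: "{a, b} \<in> edges G" "{w, b} \<in> edges G" "w \<noteq> a" "b \<notin> F \<union> F'" "w \<notin> F \<union> F'" .
      then have "(a, b) \<in> R" using inR a by blast
      moreover then have "(w, b) \<in> R" using inR' b by (auto simp: R_def)
      ultimately show "\<exists>b w. (a, b) \<in> R \<and> (w, b) \<in> R \<and> w \<noteq> a \<and> b \<notin> F \<and> w \<notin> F'"
        using b by blast
    qed
  qed
  moreover have "A \<noteq> {}" using assms(2) by auto
  ultimately obtain H where H: "H \<subseteq> R" "\<forall>a\<in>A. card (H `` {a}) = 2"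
    "\<forall>b. H\<inverse> `` {b} = {} \<or> card (H\<inverse> `` {b}) = 2"
    using countable_two_factor[OF assms(3) _ pt0] by blast
  let ?K = "\<lparr>vertices = A \<union> Range H, edges = (\<lambda>(a, b). {a, b}) ` H\<rparr>"
  have "subgraph ?K G \<and> two_regular ?K"
    by (rule two_regular_subgraph_of_pairs[OF assms(1) H(1)[unfolded R_def] H(2,3)])
  \<comment> \<open>A single, possibly disconnected, 2-regular subgraph contains all of
    \<open>A\<close>, so the collection is a singleton.\<close>
  then show ?thesis by (intro exI[of _ "{?K}"]) simp
qed

end
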